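(* Let $H$ be a real Hilbert space, let $\mathsf{A},\mathsf{B}$ be maximal monotone operators on $H$ with $S:=\mathsf{A}^{-1}(0)\cap\mathsf{B}^{-1}(0)\neq\emptyset$, let $x_0,u\in H$, $(\alpha_n),(\lambda_n)\subset(0,1)$, $(\beta_n),(\mu_n)\subset(0,+\infty)$, and let $(y_n)$ be given by $y_0=x_0$ and $$y_{2n+1}=J^{\mathsf{A}}_{\beta_n}(\alpha_n u+(1-\alpha_n)y_{2n}),\qquad y_{2n+2}=J^{\mathsf{B}}_{\mu_n}(\lambda_n u+(1-\lambda_n)y_{2n+1})\qquad(n\in\mathbb{N}).$$ Let $N\in\mathbb{N}\setminus\{0\}$ be such that $N\geq\max\{2\|u-q\|,\|x_0-q\|,\|q\|\}$ for some point $q\in S$. Assume that there exist $R\in\mathbb{N}\setminus\{0\}$ and monotone functions $\Delta,t:\mathbb{N}\to\mathbb{N}$ such that - $\Delta$ is a rate of divergence for $\sum\alpha_n=\infty$ or for $\sum\lambda_n=\infty$; - $\min\{\beta_n,\mu_n\}\geq\frac1R$ for all $n\in\mathbb{N}$; - $\max\{\beta_n,\mu_n\}\leq t(n)$ for all $n\in\mathbb{N}$. Let $\eta$ be a monotone quasi-rate of asymptotic regularity for $(y_n)$ with respect to $J^{\mathsf{A}}_{1/R}$ and $J^{\mathsf{B}}_{1/R}$, and let $\eta'$ be a monotone quasi-rate of convergence for $\|y_{n+1}-y_n\|\to0$. Then for all $k\in\mathbb{N}$ and all monotone $f:\mathbb{N}\to\mathbb{N}$ $$\exists n\leq\mu(k,f)\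 \forall i,j\in[n,f(n)]\ \left(\|y_i-y_j\|\leq\tfrac1{k+1}\right),$$ where $\mu(k,f):=\Psi[\Phi[\psi_1,\psi_2]](k,f)$, with $\psi_1(k,f):=\eta'(4k+3,2f)$ and $\psi_2(k,f):=\widetilde{\mu}(4k+3,f)$, and $\Psi,\Phi,\widetilde\mu$ are as defined in the context.
   Context: $\mathbb{N}=\{0,1,2,\dots\}$; $[n,p]$ denotes $\{m\in\mathbb{N}:n\leq m\leq p\}$ (empty if $p<n$). For $\gamma>0$, $J^{\mathsf{A}}_\gamma=(I+\gamma\mathsf{A})^{-1}$ is the (single-valued) resolvent of the maximal monotone operator $\mathsf{A}$. For $g,f:\mathbb{N}\to\mathbb{N}$, $g\leq^*f$ means: for all $m\leq n$, $g(m)\leq f(n)$ and $f(m)\leq f(n)$. A function $f:\mathbb{N}\to\mathbb{N}$ is monotone if it is nondecreasing. A functional $\varphi:\mathbb{N}\times\mathbb{N}^{\mathbb{N}}\to\mathbb{N}$ is monotone if $m\leq n$ and $g\leq^*f$ imply $\varphi(m,g)\leq\varphi(n,f)$. A rate of divergence for $\sum a_n=\infty$ is a function $\gamma:\mathbb{N}\to\mathbb{N}$ with $\sum_{i=0}^{\gamma(k)+n}a_i\geq k$ for all $k,n\in\mathbb{N}$. A quasi-rate of convergence for a real sequence $a_n\to0$ is a functional $\Gamma:\mathbb{N}\times\mathbb{N}^{\mathbb{N}}\to\mathbb{N}$ such that for all $k\in\mathbb{N}$ and $f:\mathbb{N}\to\mathbb{N}$ there is $n\leq\Gamma(k,f)$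 with $|a_m|\leq\frac1{k+1}$ for all $m\in[n,f(n)]$. A quasi-rate of asymptotic regularity for $(y_n)$ with respect to $T,T':H\to H$ is a quasi-rate of convergence for $\max\{\|T(y_n)-y_n\|,\|T'(y_n)-y_n\|\}\to0$. Definitions of the functions: - For $M\in\mathbb{N}$ and $f:\mathbb{N}\to\mathbb{N}$: $\widetilde{f}[M](m):=f(\max\{m,M\})$ and $g_f(m):=f(2m+1)$. $2f$ is the function $n\mapsto2f(n)$. - $\overline{\Phi}[\phi_1,\phi_2](k,f):=\max\{\theta,\phi_2(k,\widetilde{f}[\theta])\}$, where $\overline{f}(m):=\widetilde{f}[\phi_2(k,\widetilde{f}[m])](m)$ and $\theta:=\phi_1(k,\overline{f})$. - $\Phi[\phi_1,\phi_2](k,f):=\min\{\overline{\Phi}[\phi_1,\phi_2](k,f),\overline{\Phi}[\phi_2,\phi_1](k,f)\}$. - $\Psi[\psi](k,f):=2\psi(k,g_f)+1$. - $\sigma_1(k,n):=\Delta\big(n+\lceil\ln(16N^2(k+1))\rceil\big)+1$. - $\zeta(k,f):=24N\big(w_{f,N}^{(E)}(0)+1\big)^2$, where $w_{f,N}(m):=\max\{f(24N(m+1)^2),\,24N(m+1)^2\}$, $E:=4N^4(k+1)^2$, and $w^{(E)}$ is the $E$-fold iterate of $w$. - $\Omega_\eta(k,f):=\eta(\zeta(k,\widehat{f}),f)$, where $\widehat{f}(m):=f(\eta(m,f))$. - $\widetilde{\mu}(k,f):=\sigma_1\big(\widetilde{k},\Omega_\eta(k',2g+2)\big)$, where $\widetilde{k}:=(k+1)^2-1$,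 $k':=16(k+1)^2-1$, $p(n):=f(\sigma_1(\widetilde{k},n))$, $g(n):=64NR(k+1)^2(p(n)+1)\,t(p(n))-1$, and $2g+2$ is the function $n\mapsto2g(n)+2$. *)

theory Defs
  imports "HOL-Analysis.Analysis"
begin

text \<open>A real Hilbert space is a type of sort \<open>{real_inner, complete_space}\<close>; a set-valued operator
  on it is a map \<open>A :: 'a \<Rightarrow> 'a set\<close>, whose graph is \<open>{(x, v). v \<in> A x}\<close>.\<close>

definition monotone_operator :: "('a::real_inner \<Rightarrow> 'a set) \<Rightarrow> bool" where
  "monotone_operator A \<longleftrightarrow> (\<forall>x y. \<forall>v\<in>A x. \<forall>w\<in>A y. 0 \<le> (x - y) \<bullet> (v - w))"

definition maximal_monotone_operator :: "('a::real_inner \<Rightarrow> 'a set) \<Rightarrow> bool" where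
  "maximal_monotone_operator A \<longleftrightarrow>
     monotone_operator A \<and>
     (\<forall>B. monotone_operator B \<and> (\<forall>x. A x \<subseteq> B x) \<longrightarrow> B = A)"

definition operator_zeros :: "('a::real_inner \<Rightarrow> 'a set) \<Rightarrow> 'a set" where
  "operator_zeros A = {x. 0 \<in> A x}"

text \<open>The resolvent \<open>(I + c A)\<^sup>-\<^sup>1\<close>. The description is proper for maximal monotone \<open>A\<close> and \<open>c > 0\<close>,
  by monotonicity (uniqueness) and Minty's theorem (existence).\<close>

definition resolvent :: "real \<Rightarrow> ('a::real_inner \<Rightarrow> 'a set) \<Rightarrow> 'a \<Rightarrow> 'a" where
  "resolvent c A x = (THE z. x \<in> {z + c *\<^sub>R v | v. v \<in> A z})"

definition le_star :: "(nat \<Rightarrow> nat) \<Rightarrow> (nat \<Rightarrow> nat) \<Rightarrow> bool" (infix "\<le>\<^sup>*" 50) where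
  "g \<le>\<^sup>* f \<longleftrightarrow> (\<forall>m n. m \<le> n \<longrightarrow> g m \<le> f n \<and> f m \<le> f n)"

definition monotone_functional :: "(nat \<Rightarrow> (nat \<Rightarrow> nat) \<Rightarrow> nat) \<Rightarrow> bool" where
  "monotone_functional \<phi> \<longleftrightarrow> (\<forall>m n g f. m \<le> n \<and> g \<le>\<^sup>* f \<longrightarrow> \<phi> m g \<le> \<phi> n f)"

definition rate_of_divergence :: "(nat \<Rightarrow> nat) \<Rightarrow> (nat \<Rightarrow> real) \<Rightarrow> bool" where
  "rate_of_divergence \<gamma> a \<longleftrightarrow> (\<forall>k n. real k \<le> (\<Sum>i = 0..\<gamma> k + n. a i))"

definition quasi_rate_of_convergence ::
    "(nat \<Rightarrow> (nat \<Rightarrow> nat) \<Rightarrow> nat) \<Rightarrow> (nat \<Rightarrow> real) \<Rightarrow> bool" where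
  "quasi_rate_of_convergence \<Gamma> a \<longleftrightarrow>
     (\<forall>k f. \<exists>n\<le>\<Gamma> k f. \<forall>m\<in>{n..f n}. \<bar>a m\<bar> \<le> 1 / (real k + 1))"

definition quasi_rate_of_asymptotic_regularity ::
    "(nat \<Rightarrow> (nat \<Rightarrow> nat) \<Rightarrow> nat) \<Rightarrow> (nat \<Rightarrow> 'a::real_normed_vector) \<Rightarrow> ('a \<Rightarrow> 'a) \<Rightarrow> ('a \<Rightarrow> 'a) \<Rightarrow> bool"
  where
  "quasi_rate_of_asymptotic_regularity \<Gamma> y T T' \<longleftrightarrow>
     quasi_rate_of_convergence \<Gamma> (\<lambda>n. max (norm (T (y n) - y n)) (norm (T' (y n) - y n)))"

definition tilde :: "(nat \<Rightarrow> nat) \<Rightarrow> nat \<Rightarrow> nat \<Rightarrow> nat" where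
  "tilde f M m = f (max m M)"

definition Phi_bar ::
    "(nat \<Rightarrow> (nat \<Rightarrow> nat) \<Rightarrow> nat) \<Rightarrow> (nat \<Rightarrow> (nat \<Rightarrow> nat) \<Rightarrow> nat) \<Rightarrow> nat \<Rightarrow> (nat \<Rightarrow> nat) \<Rightarrow> nat" where
  "Phi_bar \<phi>\<^sub>1 \<phi>\<^sub>2 k f =
     (let f_bar = (\<lambda>m. tilde f (\<phi>\<^sub>2 k (tilde f m)) m);
          \<theta> = \<phi>\<^sub>1 k f_bar
      in max \<theta> (\<phi>\<^sub>2 k (tilde f \<theta>)))"

definition Phi ::
    "(nat \<Rightarrow> (nat \<Rightarrow> nat) \<Rightarrow> nat) \<Rightarrow> (nat \<Rightarrow> (nat \<Rightarrow> nat) \<Rightarrow> nat) \<Rightarrow> nat \<Rightarrow> (nat \<Rightarrow> nat) \<Rightarrow> nat" where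
  "Phi \<phi>\<^sub>1 \<phi>\<^sub>2 k f = min (Phi_bar \<phi>\<^sub>1 \<phi>\<^sub>2 k f) (Phi_bar \<phi>\<^sub>2 \<phi>\<^sub>1 k f)"

definition Psi :: "(nat \<Rightarrow> (nat \<Rightarrow> nat) \<Rightarrow> nat) \<Rightarrow> nat \<Rightarrow> (nat \<Rightarrow> nat) \<Rightarrow> nat" where
  "Psi \<psi> k f = 2 * \<psi> k (\<lambda>m. f (2 * m + 1)) + 1"

definition sigma1 :: "nat \<Rightarrow> (nat \<Rightarrow> nat) \<Rightarrow> nat \<Rightarrow> nat \<Rightarrow> nat" where
  "sigma1 N \<Delta> k n = \<Delta> (n + nat \<lceil>ln (16 * (real N)\<^sup>2 * (real k + 1))\<rceil>) + 1"

definition w_fun :: "nat \<Rightarrow> (nat \<Rightarrow> nat) \<Rightarrow> nat \<Rightarrow> nat" where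
  "w_fun N f m = max (f (24 * N * (m + 1)\<^sup>2)) (24 * N * (m + 1)\<^sup>2)"

definition zeta :: "nat \<Rightarrow> nat \<Rightarrow> (nat \<Rightarrow> nat) \<Rightarrow> nat" where
  "zeta N k f = 24 * N * ((w_fun N f ^^ (4 * N ^ 4 * (k + 1)\<^sup>2)) 0 + 1)\<^sup>2"

definition Omega :: "nat \<Rightarrow> (nat \<Rightarrow> (nat \<Rightarrow> nat) \<Rightarrow> nat) \<Rightarrow> nat \<Rightarrow> (nat \<Rightarrow> nat) \<Rightarrow> nat" where
  "Omega N \<eta> k f = \<eta> (zeta N k (\<lambda>m. f (\<eta> m f))) f"

text \<open>All subtractions below are on naturals. They do not truncate when \<open>N\<close>, \<open>R\<close> and the values of
  \<open>t\<close> are positive; the last is the case when \<open>t\<close> bounds a sequence of positive reals.\<close>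

definition mu_tilde ::
    "nat \<Rightarrow> nat \<Rightarrow> (nat \<Rightarrow> nat) \<Rightarrow> (nat \<Rightarrow> nat) \<Rightarrow> (nat \<Rightarrow> (nat \<Rightarrow> nat) \<Rightarrow> nat) \<Rightarrow> nat \<Rightarrow> (nat \<Rightarrow> nat) \<Rightarrow> nat"
  where
  "mu_tilde N R \<Delta> t \<eta> k f =
     (let k_tilde = (k + 1)\<^sup>2 - 1;
          k' = 16 * (k + 1)\<^sup>2 - 1;
          p = (\<lambda>n. f (sigma1 N \<Delta> k_tilde n));
          g = (\<lambda>n. 64 * N * R * (k + 1)\<^sup>2 * (p n + 1) * t (p n) - 1)
      in sigma1 N \<Delta> k_tilde (Omega N \<eta> k' (\<lambda>n. 2 * g n + 2)))"

definition mu ::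
    "nat \<Rightarrow> nat \<Rightarrow> (nat \<Rightarrow> nat) \<Rightarrow> (nat \<Rightarrow> nat) \<Rightarrow> (nat \<Rightarrow> (nat \<Rightarrow> nat) \<Rightarrow> nat)
      \<Rightarrow> (nat \<Rightarrow> (nat \<Rightarrow> nat) \<Rightarrow> nat) \<Rightarrow> nat \<Rightarrow> (nat \<Rightarrow> nat) \<Rightarrow> nat"
  where
  "mu N R \<Delta> t \<eta> \<eta>' =
     (let \<psi>\<^sub>1 = (\<lambda>k f. \<eta>' (4 * k + 3) (\<lambda>n. 2 * f n));
          \<psi>\<^sub>2 = (\<lambda>k f. mu_tilde N R \<Delta> t \<eta> (4 * k + 3) f)
      in Psi (Phi \<psi>\<^sub>1 \<psi>\<^sub>2))"

end

theory Submission
  imports Defs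
begin

text \<open>Minty's theorem makes the resolvents total and firmly nonexpansive. In place of the projection of
  \<open>u\<close> onto the common zeros one takes an approximate common fixed point \<open>x\<close> whose distance to \<open>u\<close> is
  almost minimal among the approximate fixed points of a lower accuracy; since these are almost
  closed under convex combinations, \<open>(u - x) \<bullet> (y m - x)\<close> is almost nonpositive wherever \<open>y m\<close> is
  approximately fixed. The squared distance of the even iterates to \<open>x\<close> then contracts by the factor
  \<open>1 - \<alpha> n\<close> or \<open>1 - lam n\<close> in each round, up to a small error, so that the divergence of the sum of the
  weights forces it below the required bound. The odd iterates are
  close to the even ones by \<open>\<eta>'\<close>.\<close>

section \<open>Resolvents of maximal monotone operators\<close>

lemma maximal_monotone_operatorD:
  assumes "maximal_monotone_operator A" "v \<in> A x" "w \<in> A y"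
  shows "0 \<le> (x - y) \<bullet> (v - w)"
  using assms by (auto simp: maximal_monotone_operator_def monotone_operator_def)

text \<open>Adding the pair \<open>(p, s)\<close> to the graph keeps the operator monotone, so by
  maximality the pair was already there.\<close>

lemma maximal_monotone_operator_related:
  assumes A: "maximal_monotone_operator A"
    and rel: "\<And>x v. v \<in> A x \<Longrightarrow> 0 \<le> (x - p) \<bullet> (v - s)"
  shows "s \<in> A p"
proof -
  define B where "B = A(p := insert s (A p))"
  have rel': "0 \<le> (p - x) \<bullet> (s - v)" if "v \<in> A x" for x v
    using rel[OF that] by (simp add: algebra_simps)
  have "0 \<le> (x - y) \<bullet> (v - w)" if "v \<in> B x" "w \<in> B y" for x y v w
    using that rel rel' maximal_monotone_operatorD[OF A]
    by (auto simp: B_def split: if_splits)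
  then have "monotone_operator B"
    by (simp add: monotone_operator_def)
  moreover have "\<forall>x. A x \<subseteq> B x"
    by (auto simp: B_def)
  ultimately have "B = A"
    using A by (simp add: maximal_monotone_operator_def)
  then show ?thesis
    by (metis B_def fun_upd_same insertI1)
qed

text \<open>The set \<open>C\<close> plays the role of the epigraph of a convex function \<open>F\<close>; the point found
  minimises \<open>F z + norm z ^ 2 / 2\<close>.\<close>

lemma strongly_convex_minimum:
  fixes C :: "('b::{real_inner, complete_space} \<times> real) set"
  assumes C: "closed C" "convex C" "C \<noteq> {}"
    and bdd: "\<And>z r. (z, r) \<in> C \<Longrightarrow> 0 \<le> r + (norm z)\<^sup>2 / 2"
  obtains z r where "(z, r) \<in> C" "\<And>z' r'. (z', r') \<in> C \<Longrightarrow> r \<le> r' + z \<bullet> (z' - z)"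
proof -
  define \<phi> :: "'b \<times> real \<Rightarrow> real" where "\<phi> w = snd w + (norm (fst w))\<^sup>2 / 2" for w
  define m where "m = Inf (\<phi> ` C)"
  have bb: "bdd_below (\<phi> ` C)"
    by (rule bdd_belowI[of _ 0]) (auto simp: \<phi>_def bdd)
  have m_le: "m \<le> \<phi> w" if "w \<in> C" for w
    unfolding m_def using bb that by (intro cInf_lower) auto
  have "\<exists>w\<in>C. \<phi> w < m + 1 / real (Suc n)" for n
  proof -
    have "Inf (\<phi> ` C) < m + 1 / real (Suc n)"
      by (simp add: m_def)
    then show ?thesis
      using cInf_lessD[of "\<phi> ` C"] C(3) by blast
  qed
  then obtain w where w: "\<And>n. w n \<in> C" "\<And>n. \<phi> (w n) < m + 1 / real (Suc n)"
    by metis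
  \<comment> \<open>Parallelogram identity: the gain at the midpoint forces the first components of
    a minimising sequence to be Cauchy.\<close>
  have mid: "\<phi> ((1 / 2) *\<^sub>R a + (1 / 2) *\<^sub>R b) = (\<phi> a + \<phi> b) / 2 - (norm (fst a - fst b))\<^sup>2 / 8" for a b
    by (simp add: \<phi>_def power2_norm_eq_inner inner_add inner_diff inner_commute field_simps)
  have dist_le: "(norm (fst (w i) - fst (w j)))\<^sup>2 \<le> 8 / real (Suc n)" if "n \<le> i" "n \<le> j" for i j n
  proof -
    have "(1 / 2) *\<^sub>R w i + (1 / 2) *\<^sub>R w j \<in> C"
      by (rule convexD[OF C(2)]) (auto simp: w)
    from m_le[OF this] have "(norm (fst (w i) - fst (w j)))\<^sup>2 / 8 \<le> (\<phi> (w i) + \<phi> (w j)) / 2 - m"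
      unfolding mid by linarith
    moreover have "1 / real (Suc i) \<le> 1 / real (Suc n)" "1 / real (Suc j) \<le> 1 / real (Suc n)"
      using that by (auto simp: frac_le)
    moreover have "\<phi> (w i) < m + 1 / real (Suc i)" "\<phi> (w j) < m + 1 / real (Suc j)"
      by (fact w(2))+
    ultimately have "(norm (fst (w i) - fst (w j)))\<^sup>2 \<le> 8 * (1 / real (Suc n))"
      by argo
    then show ?thesis by simp
  qed
  have "Cauchy (\<lambda>n. fst (w n))"
  proof (rule metric_CauchyI)
    fix e :: real assume "0 < e"
    then obtain n where n: "8 / e\<^sup>2 < real n"
      using reals_Archimedean2 by blast
    have "dist (fst (w i)) (fst (w j)) < e" if "n \<le> i" "n \<le> j" for i j
    proof -
      have "8 / real (Suc n) < e\<^sup>2"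
        using n \<open>0 < e\<close> by (simp add: field_simps)
          (smt (verit, best) zero_less_power2)
      then have "(norm (fst (w i) - fst (w j)))\<^sup>2 < e\<^sup>2"
        using dist_le[OF that] by linarith
      then show ?thesis
        using \<open>0 < e\<close> by (simp add: dist_norm power_less_imp_less_base)
    qed
    then show "\<exists>M. \<forall>i\<ge>M. \<forall>j\<ge>M. dist (fst (w i)) (fst (w j)) < e"
      by blast
  qed
  then obtain z where z: "(\<lambda>n. fst (w n)) \<longlonglongrightarrow> z"
    using Cauchy_convergent convergent_def by blast
  have "(\<lambda>n. \<phi> (w n)) \<longlonglongrightarrow> m"
  proof (rule tendsto_sandwich[of "\<lambda>_. m" _ _ "\<lambda>n. m + 1 / real (Suc n)"])
    show "(\<lambda>n. m + 1 / real (Suc n)) \<longlonglongrightarrow> m"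
      using tendsto_add[OF tendsto_const LIMSEQ_inverse_real_of_nat, of m]
      by (simp add: inverse_eq_divide)
  qed (use m_le[OF w(1)] less_imp_le[OF w(2)] in \<open>auto intro!: always_eventually\<close>)
  \<comment> \<open>The Cauchy argument does not control the second components; they converge
    because both \<open>\<phi>\<close> and the norms of the first components do.\<close>
  then have "(\<lambda>n. \<phi> (w n) - (norm (fst (w n)))\<^sup>2 / 2) \<longlonglongrightarrow> m - (norm z)\<^sup>2 / 2"
    by (intro tendsto_intros z) simp_all
  then have r: "(\<lambda>n. snd (w n)) \<longlonglongrightarrow> m - (norm z)\<^sup>2 / 2"
    by (simp add: \<phi>_def)
  define r where "r = m - (norm z)\<^sup>2 / 2"
  have "w \<longlonglongrightarrow> (z, r)"
    using tendsto_Pair[OF z r] by (simp add: r_def)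
  then have zr: "(z, r) \<in> C"
    using C(1) w(1) closed_sequentially by blast
  have "r \<le> r' + z \<bullet> (z' - z)" if z': "(z', r') \<in> C" for z' r'
  proof (rule ccontr)
    define d where "d = r - r' - z \<bullet> (z' - z)"
    define K where "K = (norm (z' - z))\<^sup>2"
    assume "\<not> ?thesis"
    then have "0 < d" by (simp add: d_def)
    have "0 \<le> K" by (simp add: K_def)
    \<comment> \<open>For this \<open>s\<close> the second-order cost
      \<open>s\<^sup>2 * K / 2\<close> is at most half of the first-order gain \<open>s * d\<close>;
      the summand \<open>d\<close> in the denominator also covers \<open>K = 0\<close>.\<close>
    define s where "s = d / (d + K)"
    have s: "0 < s" "s \<le> 1" using \<open>0 < d\<close> \<open>0 \<le> K\<close> by (auto simp: s_def)
    have "(1 - s) *\<^sub>R (z, r) + s *\<^sub>R (z', r') \<in> C"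
      using s by (intro convexD[OF C(2)] zr z') auto
    from m_le[OF this] have "r + (norm z)\<^sup>2 / 2
        \<le> (1 - s) * r + s * r' + (norm ((1 - s) *\<^sub>R z + s *\<^sub>R z'))\<^sup>2 / 2"
      by (simp add: \<phi>_def r_def)
    also have "(1 - s) *\<^sub>R z + s *\<^sub>R z' = z + s *\<^sub>R (z' - z)"
      by (simp add: algebra_simps)
    also have "(norm (z + s *\<^sub>R (z' - z)))\<^sup>2 = (norm z)\<^sup>2 + 2 * s * (z \<bullet> (z' - z)) + s\<^sup>2 * K"
      unfolding K_def power2_norm_eq_inner
      by (simp add: inner_add inner_commute power2_eq_square)
    finally have "s * r \<le> s * r' + s * (z \<bullet> (z' - z)) + s\<^sup>2 * K / 2"
      by argo
    then have "s * d \<le> s * (s * K / 2)"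
      by (simp add: d_def right_diff_distrib power2_eq_square)
    then have "d \<le> s * K / 2" using s by simp
    also have "s * K / 2 \<le> s * (d + K) / 2"
      using s \<open>0 < d\<close> by simp
    also have "\<dots> = d / 2"
      using \<open>0 < d\<close> \<open>0 \<le> K\<close> by (simp add: s_def)
    finally show False using \<open>0 < d\<close> by simp
  qed
  with zr show ?thesis by (rule that)
qed

text \<open>Minty's theorem. A minimiser \<open>(x\<^sub>0, v\<^sub>0)\<close> of \<open>F (x, v) + norm (x, v) ^ 2 / 2\<close>, where \<open>F\<close> is the
  Fitzpatrick function of \<open>A\<close>, is such that \<open>(- v\<^sub>0, - x\<^sub>0)\<close> is monotonically related to \<open>A\<close>.\<close>

lemma maximal_monotone_operator_antidiagonal:
  fixes A :: "'a::{real_inner, complete_space} \<Rightarrow> 'a set"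
  assumes A: "maximal_monotone_operator A"
  shows "\<exists>z. - z \<in> A z"
proof -
  \<comment> \<open>The epigraph of the Fitzpatrick function, a supremum of continuous affine
    functions of \<open>(x, v)\<close>; hence \<open>C\<close> is closed and convex.\<close>
  define C where "C = {((x, v), r). \<forall>a. \<forall>b\<in>A a. x \<bullet> b + a \<bullet> v - a \<bullet> b \<le> r}"
  have CI: "C = (\<Inter>a. \<Inter>b\<in>A a. {w. fst (fst w) \<bullet> b + a \<bullet> snd (fst w) - a \<bullet> b \<le> snd w})"
    by (auto simp: C_def)
  have "closed C"
    unfolding CI by (intro closed_INT ballI closed_Collect_le continuous_intros)
  have "convex C"
  proof (rule convexI)
    fix w w' s t assume w: "w \<in> C" "w' \<in> C" and st: "0 \<le> s" "0 \<le> t" "s + t = (1::real)"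
    obtain x v r x' v' r' where eq: "w = ((x, v), r)" "w' = ((x', v'), r')"
      by (metis prod.collapse)
    have "(s *\<^sub>R x + t *\<^sub>R x') \<bullet> b + a \<bullet> (s *\<^sub>R v + t *\<^sub>R v') - a \<bullet> b \<le> s * r + t * r'"
      if "b \<in> A a" for a b
    proof -
      have "(s *\<^sub>R x + t *\<^sub>R x') \<bullet> b + a \<bullet> (s *\<^sub>R v + t *\<^sub>R v') - (s + t) * (a \<bullet> b)
        = s * (x \<bullet> b + a \<bullet> v - a \<bullet> b) + t * (x' \<bullet> b + a \<bullet> v' - a \<bullet> b)"
        by (simp add: inner_add algebra_simps)
      also have "\<dots> \<le> s * r + t * r'"
        using w st that by (intro add_mono mult_left_mono) (auto simp: C_def eq)
      finally show ?thesis using st by simp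
    qed
    then show "s *\<^sub>R w + t *\<^sub>R w' \<in> C"
      by (simp add: C_def eq)
  qed
  have graph: "((a, b), a \<bullet> b) \<in> C" if "b \<in> A a" for a b
  proof -
    have "a \<bullet> b' + a' \<bullet> b - a' \<bullet> b' \<le> a \<bullet> b" if "b' \<in> A a'" for a' b'
      using maximal_monotone_operatorD[OF A \<open>b \<in> A a\<close> that]
      by (simp add: inner_diff inner_commute)
    then show ?thesis by (simp add: C_def)
  qed
  have "\<exists>a b. b \<in> A a"
    using maximal_monotone_operator_related[OF A] by blast
  then have "C \<noteq> {}" using graph by blast
  \<comment> \<open>If \<open>r < x \<bullet> v\<close>, then \<open>(x, v)\<close> is monotonically
    related to the graph, so it lies in the graph and is itself one of the test pairs, which gives
    \<open>x \<bullet> v \<le> r\<close>.\<close>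
  have fitz: "x \<bullet> v \<le> r" if w: "((x, v), r) \<in> C" for x v r
  proof (rule ccontr)
    assume r: "\<not> ?thesis"
    have le: "x \<bullet> b + a \<bullet> v - a \<bullet> b \<le> r" if "b \<in> A a" for a b
      using w that by (auto simp: C_def)
    have "v \<in> A x"
      using le r by (intro maximal_monotone_operator_related[OF A])
        (fastforce simp: inner_diff inner_commute)
    from le[OF this] r show False by simp
  qed
  have sq: "x \<bullet> v + (norm (x, v))\<^sup>2 / 2 = (norm (x + v))\<^sup>2 / 2" for x v :: 'a
    by (simp add: power2_norm_eq_inner inner_add inner_commute field_simps)
  have "0 \<le> r + (norm z)\<^sup>2 / 2" if "(z, r) \<in> C" for z r
  proof -
    obtain x v where z: "z = (x, v)" by (cases z)
    have "x \<bullet> v \<le> r"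
      using fitz that unfolding z by blast
    moreover have "0 \<le> (norm (x + v))\<^sup>2" by simp
    ultimately show ?thesis
      using sq[of x v] unfolding z by argo
  qed
  then obtain z r where zr: "(z, r) \<in> C" "\<And>z' r'. (z', r') \<in> C \<Longrightarrow> r \<le> r' + z \<bullet> (z' - z)"
    using strongly_convex_minimum[OF \<open>closed C\<close> \<open>convex C\<close> \<open>C \<noteq> {}\<close>] by blast
  obtain x v where z: "z = (x, v)" by (cases z)
  \<comment> \<open>Minimality is tested with graph points only, and \<open>r\<close> is bounded
    below by \<open>fitz\<close>. Inserting the pair \<open>(- v, - x)\<close> later makes the right
    side zero.\<close>
  have key: "(norm (x + v))\<^sup>2 \<le> (a - - v) \<bullet> (b - - x)" if "b \<in> A a" for a b
  proof -
    have "x \<bullet> v \<le> r"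
      using fitz zr(1) unfolding z by blast
    also have "r \<le> a \<bullet> b + (x, v) \<bullet> ((a, b) - (x, v))"
      using zr(2)[OF graph[OF that]] unfolding z .
    finally have "x \<bullet> v \<le> a \<bullet> b + (x, v) \<bullet> ((a, b) - (x, v))" .
    then show ?thesis
      by (simp add: power2_norm_eq_inner inner_add inner_diff inner_commute)
  qed
  have *: "- x \<in> A (- v)"
    by (rule maximal_monotone_operator_related[OF A]) (rule order_trans[OF zero_le_power2 key])
  from key[OF *] have "x + v = 0" by simp
  with * show ?thesis
    by (metis add.inverse_inverse add_eq_0_iff)
qed

text \<open>The equation says that \<open>- z\<close> lies in the rescaled and translated operator
  \<open>B\<close>. This operator is again maximal monotone, since the transformation can be undone
  on any monotone extension.\<close>

lemma minty:
  fixes A :: "'a::{real_inner, complete_space} \<Rightarrow> 'a set"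
  assumes A: "maximal_monotone_operator A" and c: "0 < c"
  shows "\<exists>z. \<exists>v\<in>A z. x = z + c *\<^sub>R v"
proof -
  define B where "B z = (\<lambda>v. c *\<^sub>R v - x) ` A z" for z
  have "maximal_monotone_operator B"
    unfolding maximal_monotone_operator_def
  proof (intro conjI allI impI)
    show "monotone_operator B"
      using maximal_monotone_operatorD[OF A] c
      by (auto simp: monotone_operator_def B_def simp flip: scaleR_diff_right)
  next
    fix B' assume B': "monotone_operator B' \<and> (\<forall>x. B x \<subseteq> B' x)"
    have "s \<in> B p" if s: "s \<in> B' p" for s p
    proof -
      have "inverse c *\<^sub>R (s + x) \<in> A p"
      proof (rule maximal_monotone_operator_related[OF A])
        fix y v assume "v \<in> A y"
        then have "c *\<^sub>R v - x \<in> B' y" using B' by (auto simp: B_def)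
        then have "0 \<le> (y - p) \<bullet> (c *\<^sub>R v - x - s)"
          using B' s by (auto simp: monotone_operator_def)
        also have "c *\<^sub>R v - x - s = c *\<^sub>R (v - inverse c *\<^sub>R (s + x))"
          using c by (simp add: algebra_simps)
        finally show "0 \<le> (y - p) \<bullet> (v - inverse c *\<^sub>R (s + x))"
          using c by (simp add: zero_le_mult_iff)
      qed
      then show ?thesis
        unfolding B_def by (rule rev_image_eqI) (use c in simp)
    qed
    then show "B' = B" using B' by blast
  qed
  then obtain z where "- z \<in> B z"
    using maximal_monotone_operator_antidiagonal by blast
  then obtain v where "v \<in> A z" "- z = c *\<^sub>R v - x"
    by (auto simp: B_def)
  then show ?thesis
    by (intro exI[of _ z] bexI[of _ v]) (auto simp: algebra_simps)
qed

section \<open>Basic inequalities for resolvents\<close>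

text \<open>Minty's theorem gives existence. For two candidates, the difference of the points is
  \<open>- c\<close> times the difference of the operator values, so monotonicity makes them equal
  and the definite description is proper.\<close>

lemma resolvent_graph:
  fixes A :: "'a::{real_inner, complete_space} \<Rightarrow> 'a set"
  assumes A: "maximal_monotone_operator A" and c: "0 < c"
  obtains v where "v \<in> A (resolvent c A x)" "x = resolvent c A x + c *\<^sub>R v"
proof -
  have "\<exists>!z. x \<in> {z + c *\<^sub>R v | v. v \<in> A z}"
  proof (rule ex_ex1I)
    show "\<exists>z. x \<in> {z + c *\<^sub>R v | v. v \<in> A z}"
      using minty[OF A c] by blast
  next
    fix z z' assume "x \<in> {z + c *\<^sub>R v | v. v \<in> A z}" "x \<in> {z' + c *\<^sub>R v | v. v \<in> A z'}"
    then obtain v v' where v: "v \<in> A z" "v' \<in> A z'" "x = z + c *\<^sub>R v" "x = z' + c *\<^sub>R v'"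
      by auto
    then have "z - z' = - (c *\<^sub>R (v - v'))"
      by (simp add: algebra_simps)
    moreover have "0 \<le> c * ((z - z') \<bullet> (v - v'))"
      using maximal_monotone_operatorD[OF A v(1,2)] c by simp
    ultimately have "(z - z') \<bullet> (z - z') \<le> 0"
      by (metis inner_minus_right inner_scaleR_right neg_le_0_iff_le)
    then show "z = z'" by (simp flip: power2_norm_eq_inner)
  qed
  from theI'[OF this] have "x \<in> {resolvent c A x + c *\<^sub>R v | v. v \<in> A (resolvent c A x)}"
    unfolding resolvent_def .
  then show ?thesis using that by blast
qed

text \<open>\<open>x - y\<close> is the difference of the resolvents plus \<open>c\<close> times a
  difference of operator values; paired with the former, the second summand is nonnegative.\<close>

lemma resolvent_firmly_nonexpansive:
  fixes A :: "'a::{real_inner, complete_space} \<Rightarrow> 'a set"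
  assumes A: "maximal_monotone_operator A" and c: "0 < c"
  shows "(norm (resolvent c A x - resolvent c A y))\<^sup>2 \<le> (x - y) \<bullet> (resolvent c A x - resolvent c A y)"
proof -
  let ?J = "resolvent c A"
  obtain v where v: "v \<in> A (?J x)" "x = ?J x + c *\<^sub>R v"
    using resolvent_graph[OF A c] .
  obtain w where w: "w \<in> A (?J y)" "y = ?J y + c *\<^sub>R w"
    using resolvent_graph[OF A c] .
  have "x - ?J x = c *\<^sub>R v" "y - ?J y = c *\<^sub>R w"
    using v(2) w(2) by (metis add_diff_cancel_left')+
  then have "x - y = (?J x - ?J y) + c *\<^sub>R (v - w)"
    by (simp add: scaleR_diff_right flip: \<open>x - ?J x = _\<close> \<open>y - ?J y = _\<close>)
  then have "(x - y) \<bullet> (?J x - ?J y)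
      = (norm (?J x - ?J y))\<^sup>2 + c * ((?J x - ?J y) \<bullet> (v - w))"
    by (simp add: inner_add inner_commute power2_norm_eq_inner)
  then show ?thesis
    using maximal_monotone_operatorD[OF A v(1) w(1)] c by simp
qed

lemma resolvent_nonexpansive:
  fixes A :: "'a::{real_inner, complete_space} \<Rightarrow> 'a set"
  assumes "maximal_monotone_operator A" and "0 < c"
  shows "norm (resolvent c A x - resolvent c A y) \<le> norm (x - y)"
proof -
  let ?d = "norm (resolvent c A x - resolvent c A y)"
  have "?d * ?d \<le> norm (x - y) * ?d"
    using resolvent_firmly_nonexpansive[OF assms, of x y]
      norm_cauchy_schwarz[of "x - y" "resolvent c A x - resolvent c A y"]
    by (simp add: power2_eq_square)
  then show ?thesis
    by (cases "?d = 0") auto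
qed

lemma resolvent_zero:
  fixes A :: "'a::{real_inner, complete_space} \<Rightarrow> 'a set"
  assumes A: "maximal_monotone_operator A" and c: "0 < c" and q: "q \<in> operator_zeros A"
  shows "resolvent c A q = q"
proof -
  obtain v where v: "v \<in> A (resolvent c A q)" "q = resolvent c A q + c *\<^sub>R v"
    using resolvent_graph[OF A c] .
  then have "resolvent c A q - q = - (c *\<^sub>R v)"
    by (metis add_diff_cancel_left' diff_add_cancel minus_diff_eq)
  moreover have "0 \<le> (resolvent c A q - q) \<bullet> (v - 0)"
    using q by (intro maximal_monotone_operatorD[OF A v(1)]) (simp add: operator_zeros_def)
  ultimately have "v = 0"
    using c by (simp add: mult_le_0_iff flip: power2_norm_eq_inner)
  with v(2) show ?thesis by (metis add.right_neutral scaleR_zero_right)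
qed

text \<open>\<open>v\<close> and \<open>w\<close> are the Yosida approximations at \<open>x\<close>
  for the parameters \<open>d\<close> and \<open>c\<close>, and their norm does not increase with
  the parameter. This reduces all step sizes to the single parameter
  \<open>1 / real R\<close>.\<close>

lemma resolvent_displacement_le:
  fixes A :: "'a::{real_inner, complete_space} \<Rightarrow> 'a set"
  assumes A: "maximal_monotone_operator A" and c: "0 < c" "c \<le> d"
  shows "norm (resolvent d A x - x) \<le> d / c * norm (resolvent c A x - x)"
proof -
  have d: "0 < d" using c by simp
  obtain v where v: "v \<in> A (resolvent d A x)" "x = resolvent d A x + d *\<^sub>R v"
    using resolvent_graph[OF A d] .
  obtain w where w: "w \<in> A (resolvent c A x)" "x = resolvent c A x + c *\<^sub>R w"
    using resolvent_graph[OF A c(1)] .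
  have eqs: "resolvent d A x = x - d *\<^sub>R v" "resolvent c A x = x - c *\<^sub>R w"
    using v(2) w(2) by (metis add_diff_cancel_right')+
  have "0 \<le> (c *\<^sub>R w - d *\<^sub>R v) \<bullet> (v - w)"
    using maximal_monotone_operatorD[OF A v(1) w(1)] by (simp add: eqs)
  also have "\<dots> = (c + d) * (v \<bullet> w) - c * (norm w)\<^sup>2 - d * (norm v)\<^sup>2"
    unfolding power2_norm_eq_inner by (simp add: inner_diff inner_commute algebra_simps)
  also have "\<dots> \<le> (c + d) * (norm v * norm w) - c * (norm w)\<^sup>2 - d * (norm v)\<^sup>2"
    using c norm_cauchy_schwarz[of v w] by (simp add: mult_left_mono)
  also have "\<dots> = (norm w - norm v) * (d * norm v - c * norm w)"
    by (simp add: algebra_simps power2_eq_square)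
  finally have *: "0 \<le> (norm w - norm v) * (d * norm v - c * norm w)" .
  \<comment> \<open>Otherwise \<open>c \<le> d\<close> would make the second factor of the product
    positive while the first is negative.\<close>
  have "norm v \<le> norm w"
  proof (rule ccontr)
    assume "\<not> ?thesis"
    then have less: "norm w < norm v" by simp
    have "c * norm w \<le> d * norm w" using c by (simp add: mult_right_mono)
    also have "\<dots> < d * norm v" using less d by simp
    finally show False using * less by (simp add: zero_le_mult_iff)
  qed
  then show ?thesis using c d by (simp add: eqs)
qed

section \<open>Approximate projection onto the common fixed points\<close>

text \<open>\<open>T v\<close> is at most \<open>\<delta>\<close> farther from \<open>x\<close> and
  from \<open>z\<close> than \<open>v\<close> is, and by Stewart's identity these two distances
  determine its distance to \<open>v\<close>. The displacement is thus of the order of the square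
  root of \<open>\<delta>\<close>.\<close>

lemma nonexpansive_displacement_segment:
  fixes T :: "'a::real_inner \<Rightarrow> 'a"
  assumes T: "\<And>x y. norm (T x - T y) \<le> norm (x - y)"
    and x: "norm (T x - x) \<le> \<delta>" and z: "norm (T z - z) \<le> \<delta>"
    and s: "0 \<le> s" "s \<le> 1"
  defines "v \<equiv> (1 - s) *\<^sub>R x + s *\<^sub>R z"
  shows "(norm (T v - v))\<^sup>2 \<le> \<delta> * norm (x - z) + \<delta>\<^sup>2"
proof -
  define d where "d = norm (x - z)"
  have \<delta>: "0 \<le> \<delta>" using x norm_ge_zero order_trans by blast
  have "v - x = s *\<^sub>R (z - x)" "v - z = (1 - s) *\<^sub>R (x - z)"
    by (simp_all add: v_def algebra_simps)
  then have n: "norm (v - x) = s * d" "norm (v - z) = (1 - s) * d"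
    using s by (simp_all add: d_def norm_minus_commute)
  have P: "norm (T v - x) \<le> s * d + \<delta>"
    using norm_triangle_ineq[of "T v - T x" "T x - x"] T[of v x] x n by simp
  have Q: "norm (T v - z) \<le> (1 - s) * d + \<delta>"
    using norm_triangle_ineq[of "T v - T z" "T z - z"] T[of v z] z n by simp
  have stewart: "(norm ((1 - s) *\<^sub>R a + s *\<^sub>R b))\<^sup>2
      = (1 - s) * (norm a)\<^sup>2 + s * (norm b)\<^sup>2 - s * (1 - s) * (norm (b - a))\<^sup>2" for a b :: 'a
    unfolding power2_norm_eq_inner
    by (simp add: inner_add inner_diff inner_commute algebra_simps)
  have "T v - v = (1 - s) *\<^sub>R (T v - x) + s *\<^sub>R (T v - z)"
    by (simp add: v_def algebra_simps)
  then have "(norm (T v - v))\<^sup>2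
      = (1 - s) * (norm (T v - x))\<^sup>2 + s * (norm (T v - z))\<^sup>2 - s * (1 - s) * d\<^sup>2"
    by (simp add: stewart d_def)
  also have "\<dots> \<le> (1 - s) * (s * d + \<delta>)\<^sup>2 + s * ((1 - s) * d + \<delta>)\<^sup>2 - s * (1 - s) * d\<^sup>2"
    using P Q s by (intro diff_right_mono add_mono mult_left_mono power_mono) auto
  also have "\<dots> = 4 * s * (1 - s) * (\<delta> * d) + \<delta>\<^sup>2"
    by (simp add: power2_eq_square algebra_simps)
  also have "\<dots> \<le> \<delta> * d + \<delta>\<^sup>2"
  proof -
    have "4 * s * (1 - s) = 1 - (2 * s - 1)\<^sup>2"
      by (simp add: power2_eq_square algebra_simps)
    then have "4 * s * (1 - s) \<le> 1" by simp
    then have "4 * s * (1 - s) * (\<delta> * d) \<le> 1 * (\<delta> * d)"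
      using \<delta> by (intro mult_right_mono) (auto simp: d_def)
    then show ?thesis by simp
  qed
  finally show ?thesis by (simp add: d_def)
qed

text \<open>Accuracy is coded by a natural number, so the sets shrink as \<open>m\<close> grows. The
  ball around \<open>q\<close> keeps their diameter at most \<open>2 * N\<close>.\<close>

definition approx_common_fixed ::
    "('a::real_inner \<Rightarrow> 'a) \<Rightarrow> ('a \<Rightarrow> 'a) \<Rightarrow> 'a \<Rightarrow> nat \<Rightarrow> nat \<Rightarrow> 'a set" where
  "approx_common_fixed T T' q N m = {z. norm (z - q) \<le> real N \<and>
     norm (T z - z) \<le> 1 / (real m + 1) \<and> norm (T' z - z) \<le> 1 / (real m + 1)}"

lemma approx_common_fixed_antimono:
  assumes "m \<le> n"
  shows "approx_common_fixed T T' q N n \<subseteq> approx_common_fixed T T' q N m"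
proof -
  have "1 / (real n + 1) \<le> 1 / (real m + 1)"
    using assms by (simp add: frac_le)
  then show ?thesis by (auto simp: approx_common_fixed_def)
qed

text \<open>For endpoints of accuracy \<open>\<delta>\<close> the squared displacement is at most
  \<open>2 * N * \<delta> + \<delta>\<^sup>2\<close>, hence at most
  \<open>24 * N * \<delta>\<close>; taking the root is why \<open>m + 1\<close> enters
  \<open>w_fun\<close> squared.\<close>

lemma approx_common_fixed_segment:
  fixes T T' :: "'a::real_inner \<Rightarrow> 'a"
  assumes T: "\<And>x y. norm (T x - T y) \<le> norm (x - y)"
    and T': "\<And>x y. norm (T' x - T' y) \<le> norm (x - y)"
    and N: "N \<noteq> 0"
    and x: "x \<in> approx_common_fixed T T' q N (24 * N * (m + 1)\<^sup>2)"
    and z: "z \<in> approx_common_fixed T T' q N (24 * N * (m + 1)\<^sup>2)"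
    and s: "0 \<le> s" "s \<le> 1"
  shows "(1 - s) *\<^sub>R x + s *\<^sub>R z \<in> approx_common_fixed T T' q N m"
proof -
  define v where "v = (1 - s) *\<^sub>R x + s *\<^sub>R z"
  define \<delta> where "\<delta> = 1 / (real (24 * N * (m + 1)\<^sup>2) + 1)"
  have N1: "1 \<le> real N" using N by simp
  have "v \<in> cball q (real N)"
    unfolding v_def using x z s
    by (intro convexD[OF convex_cball]) (auto simp: approx_common_fixed_def dist_norm norm_minus_commute)
  then have v: "norm (v - q) \<le> real N"
    by (simp add: dist_norm norm_minus_commute)
  have xz: "norm (x - z) \<le> 2 * real N"
    using norm_triangle_ineq4[of "x - q" "z - q"] x z by (simp add: approx_common_fixed_def)
  have \<delta>: "0 < \<delta>" "\<delta> \<le> 1" "24 * real N * (real m + 1)\<^sup>2 * \<delta> \<le> 1"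
    by (auto simp: \<delta>_def field_simps add_pos_nonneg)
  have "\<delta> * norm (x - z) + \<delta>\<^sup>2 \<le> \<delta> * (2 * real N) + \<delta> * real N"
    using xz \<delta> N1 unfolding power2_eq_square
    by (intro add_mono mult_left_mono) auto
  also have "\<dots> \<le> 24 * real N * \<delta>"
    using \<delta> N1 by simp
  also have "\<dots> \<le> (1 / (real m + 1))\<^sup>2"
  proof -
    have "24 * real N * \<delta> * (real m + 1)\<^sup>2 \<le> 1"
      using \<delta>(3) by (simp add: mult_ac)
    then show ?thesis
      unfolding power_divide by (subst pos_le_divide_eq) auto
  qed
  finally have *: "\<delta> * norm (x - z) + \<delta>\<^sup>2 \<le> (1 / (real m + 1))\<^sup>2" .
  have "norm (S v - v) \<le> 1 / (real m + 1)"
    if S: "\<And>x y. norm (S x - S y) \<le> norm (x - y)" "norm (S x - x) \<le> \<delta>" "norm (S z - z) \<le> \<delta>" for S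
    using order_trans[OF nonexpansive_displacement_segment[OF S s, folded v_def] *]
    by (rule power2_le_imp_le) simp
  from this[of T] this[of T'] v T T' x z show ?thesis
    unfolding v_def[symmetric] by (simp add: approx_common_fixed_def \<delta>_def)
qed

text \<open>If all \<open>E\<close> increments exceeded \<open>b / E\<close>, telescoping would push
  \<open>m E\<close> above \<open>b\<close>.\<close>

lemma small_increment:
  fixes m :: "nat \<Rightarrow> real"
  assumes "0 < E" "0 \<le> m 0" "m E \<le> b"
  shows "\<exists>i<E. m (Suc i) \<le> m i + b / real E"
proof (rule ccontr)
  assume "\<not> ?thesis"
  then have less: "b / real E < m (Suc i) - m i" if "i < E" for i
    using that by force
  have "(\<Sum>i<E. b / real E) < (\<Sum>i<E. m (Suc i) - m i)"
    using assms(1) less by (intro sum_strict_mono) auto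
  then show False
    using assms by (simp add: sum_lessThan_telescope)
qed

text \<open>Along the nested sets of approximate fixed points of accuracy \<open>(w_fun N f ^^ i) 0\<close>, the squared
  distance to \<open>u\<close> cannot increase substantially at every one of the \<open>E\<close> steps.\<close>

lemma approximate_projection:
  fixes T T' :: "'a::real_inner \<Rightarrow> 'a"
  assumes T: "\<And>x y. norm (T x - T y) \<le> norm (x - y)" "T q = q"
    and T': "\<And>x y. norm (T' x - T' y) \<le> norm (x - y)" "T' q = q"
    and N: "N \<noteq> 0" "2 * norm (u - q) \<le> real N"
  shows "\<exists>n\<le>zeta N k f. \<exists>x\<in>approx_common_fixed T T' q N (f n).
    \<forall>z\<in>approx_common_fixed T T' q N n. (u - x) \<bullet> (z - x) \<le> 1 / (real k + 1)"
proof -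
  define D where "D = approx_common_fixed T T' q N"
  define W where "W i = (w_fun N f ^^ i) 0" for i
  define E where "E = 4 * N ^ 4 * (k + 1)\<^sup>2"
  define c where "c i = 24 * N * (W i + 1)\<^sup>2" for i
  have WSuc: "W (Suc i) = max (f (c i)) (c i)" for i
    by (simp add: W_def c_def w_fun_def)
  have Wc: "W i \<le> c i" for i
  proof -
    have "W i \<le> 1 * (W i + 1)\<^sup>2" by (simp add: power2_eq_square)
    also have "\<dots> \<le> c i" unfolding c_def using N(1) by (intro mult_right_mono) auto
    finally show ?thesis .
  qed
  have mono_W: "mono W"
    unfolding mono_iff_le_Suc using Wc WSuc by (metis le_max_iff_disj)
  have q: "q \<in> D m" for m
    by (simp add: D_def approx_common_fixed_def T T')
  define m where "m i = Inf ((\<lambda>v. (norm (u - v))\<^sup>2) ` D (W i))" for i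
  have bdd: "bdd_below ((\<lambda>v. (norm (u - v))\<^sup>2) ` X)" for X
    by (rule bdd_belowI[of _ 0]) auto
  have m_le: "m i \<le> (norm (u - v))\<^sup>2" if "v \<in> D (W i)" for i v
    unfolding m_def using bdd that by (intro cInf_lower) auto
  have "0 \<le> m 0"
    unfolding m_def using q by (intro cInf_greatest) auto
  moreover have "m E \<le> (real N)\<^sup>2 / 4"
  proof -
    have "(norm (u - q))\<^sup>2 \<le> (real N / 2)\<^sup>2"
      using N(2) by (intro power_mono) auto
    then show ?thesis
      using m_le[OF q, of E] by (simp add: power_divide)
  qed
  moreover have "0 < E" using N(1) by (simp add: E_def)
  ultimately obtain i where i: "i < E" "m (Suc i) \<le> m i + (real N)\<^sup>2 / 4 / real E"
    using small_increment by blast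
  \<comment> \<open>The exponent \<open>E\<close> of \<open>zeta\<close> is chosen to make this
    increment equal to the \<open>\<epsilon>\<close> below.\<close>
  have eps: "(real N)\<^sup>2 / 4 / real E = 1 / (16 * (real N)\<^sup>2 * (real k + 1)\<^sup>2)"
  proof -
    have "real E = 4 * ((real N)\<^sup>2 * (real N)\<^sup>2) * (real k + 1)\<^sup>2"
      by (simp add: E_def add.commute flip: power_add)
    then show ?thesis using N(1) by (simp add: divide_simps)
  qed
  define \<epsilon> where "\<epsilon> = 1 / (16 * (real N)\<^sup>2 * (real k + 1)\<^sup>2)"
  have "0 < \<epsilon>" using N(1) by (simp add: \<epsilon>_def)
  \<comment> \<open>The infimum need not be attained, so \<open>x\<close> is only
    \<open>\<epsilon>\<close>-optimal; with the small increment this gives the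
    \<open>2 * \<epsilon>\<close> in \<open>min\<close>.\<close>
  have "Inf ((\<lambda>v. (norm (u - v))\<^sup>2) ` D (W (Suc i))) < m (Suc i) + \<epsilon>"
    using \<open>0 < \<epsilon>\<close> by (simp add: m_def)
  then obtain x where x: "x \<in> D (W (Suc i))" "(norm (u - x))\<^sup>2 < m (Suc i) + \<epsilon>"
    using cInf_lessD[of "(\<lambda>v. (norm (u - v))\<^sup>2) ` D (W (Suc i))"] q by blast
  have min: "(norm (u - x))\<^sup>2 \<le> (norm (u - v))\<^sup>2 + 2 * \<epsilon>" if "v \<in> D (W i)" for v
    using m_le[OF that] x(2) i(2) unfolding eps \<epsilon>_def[symmetric] by linarith
  \<comment> \<open>The maximum in \<open>w_fun\<close> serves both purposes: \<open>f (c i)\<close>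
    is the accuracy requested of \<open>x\<close>, and \<open>c i\<close> keeps segments starting at
    \<open>x\<close> inside \<open>D (W i)\<close>.\<close>
  have "x \<in> D (f (c i))" "x \<in> D (c i)"
    using x(1) approx_common_fixed_antimono[of _ "W (Suc i)" T T' q N]
    unfolding D_def WSuc by (meson max.cobounded1 max.cobounded2 subsetD)+
  have "(u - x) \<bullet> (z - x) \<le> 1 / (real k + 1)" if z: "z \<in> D (c i)" for z
  proof -
    \<comment> \<open>Then \<open>s\<^sup>2 * (2 * N)\<^sup>2\<close> equals
      \<open>s / (k + 1)\<close> and \<open>2 * \<epsilon>\<close> is half of it, so together they
      stay below \<open>2 * s / (k + 1)\<close>.\<close>
    define s where "s = 1 / (4 * (real N)\<^sup>2 * (real k + 1))"
    have N1: "1 \<le> (real N)\<^sup>2" using N(1) by simp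
    have s: "0 < s" "s \<le> 1"
    proof -
      show "0 < s" using N(1) by (simp add: s_def)
      have "1 * 1 \<le> 4 * (real N)\<^sup>2 * (real k + 1)"
        using N1 by (intro mult_mono) auto
      then show "s \<le> 1" using N(1) by (simp add: s_def pos_divide_le_eq)
    qed
    have "(1 - s) *\<^sub>R x + s *\<^sub>R z \<in> D (W i)"
      using \<open>x \<in> D (c i)\<close> z s N(1) unfolding D_def c_def
      by (intro approx_common_fixed_segment T T') auto
    from min[OF this] have "(norm (u - x))\<^sup>2 \<le> (norm (u - ((1 - s) *\<^sub>R x + s *\<^sub>R z)))\<^sup>2 + 2 * \<epsilon>" .
    also have "u - ((1 - s) *\<^sub>R x + s *\<^sub>R z) = (u - x) - s *\<^sub>R (z - x)"
      by (simp add: algebra_simps)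
    also have "(norm ((u - x) - s *\<^sub>R (z - x)))\<^sup>2
        = (norm (u - x))\<^sup>2 - 2 * s * ((u - x) \<bullet> (z - x)) + s\<^sup>2 * (norm (z - x))\<^sup>2"
      unfolding power2_norm_eq_inner
      by (simp add: inner_diff inner_commute power2_eq_square algebra_simps)
    finally have "2 * s * ((u - x) \<bullet> (z - x)) \<le> s\<^sup>2 * (norm (z - x))\<^sup>2 + 2 * \<epsilon>"
      by simp
    also have "(norm (z - x))\<^sup>2 \<le> (2 * real N)\<^sup>2"
      using norm_triangle_ineq4[of "z - q" "x - q"] z \<open>x \<in> D (c i)\<close>
      by (intro power_mono) (auto simp: D_def approx_common_fixed_def)
    also have "s\<^sup>2 * (2 * real N)\<^sup>2 + 2 * \<epsilon> \<le> 2 * s * (1 / (real k + 1))"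
    proof -
      have "s\<^sup>2 * (2 * real N)\<^sup>2 = s * (s * (4 * (real N)\<^sup>2))"
        by (simp add: power2_eq_square)
      also have "s * (4 * (real N)\<^sup>2) = 1 / (real k + 1)"
        using N(1) by (simp add: s_def)
      finally have "s\<^sup>2 * (2 * real N)\<^sup>2 = s * (1 / (real k + 1))" .
      moreover have "\<epsilon> = s * (1 / (real k + 1)) / 4"
        by (simp add: \<epsilon>_def s_def power2_eq_square)
      moreover have "0 \<le> s * (1 / (real k + 1))"
        using s by simp
      moreover have "a + 2 * e \<le> 2 * b" if "a = b" "e = b / 4" "0 \<le> b" for a b e :: real
        using that by simp
      ultimately show ?thesis
        unfolding mult.assoc[of 2 s] by blast
    qed
    finally have "2 * s * ((u - x) \<bullet> (z - x)) \<le> 2 * s * (1 / (real k + 1))"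
      using s by (simp add: mult_left_mono)
    then show ?thesis by (rule mult_left_le_imp_le) (use s in simp)
  qed
  moreover have "c i \<le> zeta N k f"
  proof -
    have "W i \<le> W E" using mono_W i(1) by (simp add: monoD)
    then have "c i \<le> c E" unfolding c_def by (intro mult_left_mono power_mono) auto
    then show ?thesis by (simp add: c_def zeta_def W_def E_def)
  qed
  ultimately show ?thesis
    using \<open>x \<in> D (f (c i))\<close> unfolding D_def by blast
qed

section \<open>From the approximate projection to the iterates\<close>

lemma le_starI:
  assumes "mono f" "\<And>n. g n \<le> f n"
  shows "g \<le>\<^sup>* f"
  using assms by (auto simp: le_star_def dest: monoD intro: order_trans)

lemma monotone_functionalD:
  assumes "monotone_functional \<phi>" "m \<le> n" "mono f" "\<And>n. g n \<le> f n"
  shows "\<phi> m g \<le> \<phi> n f"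
  using assms le_starI unfolding monotone_functional_def by blast

text \<open>The iterates are fixed up to \<open>1 / (n + 1)\<close> on a stretch starting at some
  \<open>n' \<le> \<eta> n f\<close>. Hence \<open>x\<close> is requested with accuracy
  \<open>f (\<eta> n f)\<close>, which dominates \<open>f n'\<close>, and the index returned is
  \<open>n'\<close>.\<close>

lemma Omega_projection:
  fixes T T' :: "'a::real_inner \<Rightarrow> 'a"
  assumes T: "\<And>x y. norm (T x - T y) \<le> norm (x - y)" "T q = q"
    and T': "\<And>x y. norm (T' x - T' y) \<le> norm (x - y)" "T' q = q"
    and N: "N \<noteq> 0" "2 * norm (u - q) \<le> real N"
    and y: "\<And>n. norm (y n - q) \<le> real N"
    and \<eta>: "monotone_functional \<eta>" "quasi_rate_of_asymptotic_regularity \<eta> y T T'"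
    and f: "mono f"
  shows "\<exists>n\<le>Omega N \<eta> k f. \<exists>x\<in>approx_common_fixed T T' q N (f n).
    \<forall>m\<in>{n..f n}. (u - x) \<bullet> (y m - x) \<le> 1 / (real k + 1)"
proof -
  obtain n x where n: "n \<le> zeta N k (\<lambda>m. f (\<eta> m f))"
    and x: "x \<in> approx_common_fixed T T' q N (f (\<eta> n f))"
    and proj: "\<And>z. z \<in> approx_common_fixed T T' q N n \<Longrightarrow> (u - x) \<bullet> (z - x) \<le> 1 / (real k + 1)"
    using approximate_projection[OF T T' N, where f = "\<lambda>m. f (\<eta> m f)" and k = k] by blast
  obtain n' where n': "n' \<le> \<eta> n f"
    and reg: "\<And>m. m \<in> {n'..f n'} \<Longrightarrow>
      \<bar>max (norm (T (y m) - y m)) (norm (T' (y m) - y m))\<bar> \<le> 1 / (real n + 1)"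
    using \<eta>(2) unfolding quasi_rate_of_asymptotic_regularity_def quasi_rate_of_convergence_def
    by meson
  have "n' \<le> Omega N \<eta> k f"
    unfolding Omega_def
    using n' monotone_functionalD[OF \<eta>(1) n f order_refl] by (rule order_trans)
  moreover have "x \<in> approx_common_fixed T T' q N (f n')"
    using x approx_common_fixed_antimono[OF monoD[OF f n']] by blast
  moreover have "(u - x) \<bullet> (y m - x) \<le> 1 / (real k + 1)" if "m \<in> {n'..f n'}" for m
    using reg[OF that] y[of m] by (intro proj) (auto simp: approx_common_fixed_def)
  ultimately show ?thesis by blast
qed

text \<open>The weight \<open>a\<close> need not tend to zero: firm nonexpansiveness leads to the inner product with the
  new iterate, instead of the old one plus an error of order \<open>a\<^sup>2\<close>.\<close>

lemma resolvent_step: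
  fixes A :: "'a::{real_inner, complete_space} \<Rightarrow> 'a set"
  assumes A: "maximal_monotone_operator A" and c: "0 < c"
    and a: "0 \<le> a" "a \<le> 1"
    and z: "z = resolvent c A (a *\<^sub>R u + (1 - a) *\<^sub>R y)"
    and bounds: "norm (u - q) \<le> N" "norm (y - q) \<le> N" "norm (z - q) \<le> N" "norm (x - q) \<le> N"
    and x: "norm (resolvent c A x - x) \<le> \<delta>"
    and \<rho>: "(u - x) \<bullet> (z - x) \<le> \<rho>" and X: "0 \<le> X" "(norm (y - x))\<^sup>2 \<le> \<rho> + X"
  shows "(norm (z - x))\<^sup>2 \<le> \<rho> + (1 - a) * X + 12 * N * \<delta>"
proof -
  define v where "v = a *\<^sub>R u + (1 - a) *\<^sub>R y"
  define d where "d = x - resolvent c A x"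
  have d: "norm d \<le> \<delta>" using x by (simp add: d_def norm_minus_commute)
  have N: "0 \<le> N" using bounds(1) norm_ge_zero order_trans by blast
  have \<delta>: "0 \<le> \<delta>" using d norm_ge_zero order_trans by blast
  have "v \<in> cball q N"
    unfolding v_def using a bounds
    by (intro convexD[OF convex_cball]) (auto simp: dist_norm norm_minus_commute)
  then have "norm (v - q) \<le> N" by (simp add: dist_norm norm_minus_commute)
  then have vx: "norm (v - x) \<le> 2 * N"
    using norm_triangle_ineq4[of "v - q" "x - q"] bounds by simp
  have zx: "norm (z - x) \<le> 2 * N"
    using norm_triangle_ineq4[of "z - q" "x - q"] bounds by simp
  have norm_add: "(norm (a + b))\<^sup>2 = (norm a)\<^sup>2 + 2 * (a \<bullet> b) + (norm b)\<^sup>2"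
    and norm_diff: "(norm (a - b))\<^sup>2 = (norm a)\<^sup>2 - 2 * (a \<bullet> b) + (norm b)\<^sup>2" for a b :: 'a
    by (simp_all add: power2_norm_eq_inner inner_add inner_diff inner_commute)
  \<comment> \<open>Firm nonexpansiveness at \<open>v\<close> and \<open>x\<close>, where
    \<open>resolvent c A x = x - d\<close>. The doubled cross term with \<open>d\<close> will cost
    \<open>4 * N * \<delta>\<close>, and \<open>(v - x) \<bullet> d\<close> another
    \<open>2 * N * \<delta>\<close>.\<close>
  have "(norm ((z - x) + d))\<^sup>2 \<le> (v - x) \<bullet> ((z - x) + d)"
    using resolvent_firmly_nonexpansive[OF A c, of v x] unfolding z v_def d_def by simp
  then have "(norm (z - x))\<^sup>2 + 2 * ((z - x) \<bullet> d) + (norm d)\<^sup>2 \<le> (v - x) \<bullet> (z - x) + (v - x) \<bullet> d"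
    by (simp only: norm_add inner_add_right)
  moreover have "(v - x) \<bullet> d \<le> 2 * N * \<delta>"
    using norm_cauchy_schwarz[of "v - x" d] mult_mono[OF vx d] N by simp
  moreover have "- ((z - x) \<bullet> d) \<le> 2 * N * \<delta>"
  proof -
    have "- ((z - x) \<bullet> d) \<le> norm (- (z - x)) * norm d"
      using norm_cauchy_schwarz[of "- (z - x)" d] by (simp only: inner_minus_left)
    also have "\<dots> \<le> 2 * N * \<delta>"
      unfolding norm_minus_cancel using N by (intro mult_mono zx d) auto
    finally show ?thesis .
  qed
  moreover have "0 \<le> (norm d)\<^sup>2" by simp
  ultimately have "(norm (z - x))\<^sup>2 \<le> (v - x) \<bullet> (z - x) + 6 * N * \<delta>"
    by linarith
  also have "v - x = a *\<^sub>R (u - x) + (1 - a) *\<^sub>R (y - x)"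
    by (simp add: v_def algebra_simps)
  also have "(a *\<^sub>R (u - x) + (1 - a) *\<^sub>R (y - x)) \<bullet> (z - x)
      = a * ((u - x) \<bullet> (z - x)) + (1 - a) * ((y - x) \<bullet> (z - x))"
    by (simp add: inner_add_left)
  also have "a * ((u - x) \<bullet> (z - x)) \<le> a * \<rho>"
    using \<rho> a by (intro mult_left_mono)
  also have "(y - x) \<bullet> (z - x) \<le> (\<rho> + X + (norm (z - x))\<^sup>2) / 2"
  proof -
    have "0 \<le> (norm ((y - x) - (z - x)))\<^sup>2" by simp
    also have "\<dots> = (norm (y - x))\<^sup>2 - 2 * ((y - x) \<bullet> (z - x)) + (norm (z - x))\<^sup>2"
      by (rule norm_diff)
    finally show ?thesis using X(2) by argo
  qed
  finally have main: "(norm (z - x))\<^sup>2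
      \<le> a * \<rho> + (1 - a) * ((\<rho> + X + (norm (z - x))\<^sup>2) / 2) + 6 * N * \<delta>"
    using a by (simp add: mult_left_mono)
  define Y where "Y = (norm (z - x))\<^sup>2 - \<rho>"
  have "(1 + a) * Y \<le> (1 - a) * X + 12 * N * \<delta>"
    using main by (simp add: Y_def field_simps)
  moreover have "0 \<le> (1 - a) * X + 12 * N * \<delta>"
    using a X N \<delta> by simp
  moreover have "Y \<le> (1 + a) * Y" if "0 \<le> Y"
    using that a by (simp add: algebra_simps)
  ultimately show ?thesis
    unfolding Y_def by fastforce
qed

section \<open>Metastability of the alternating resolvents\<close>

lemma zeta_mono:
  assumes "mono g" "\<And>n. f n \<le> g n"
  shows "zeta N k f \<le> zeta N k g"
proof -
  have w: "w_fun N f m \<le> w_fun N g n" if "m \<le> n" for m n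
  proof -
    have le: "24 * N * (m + 1)\<^sup>2 \<le> 24 * N * (n + 1)\<^sup>2"
      using that by (intro mult_le_mono2 power_mono) auto
    have "f (24 * N * (m + 1)\<^sup>2) \<le> g (24 * N * (n + 1)\<^sup>2)"
      using assms(2) monoD[OF assms(1) le] by (rule order_trans)
    then show ?thesis unfolding w_fun_def using le by (rule max.mono)
  qed
  have "(w_fun N f ^^ i) 0 \<le> (w_fun N g ^^ i) 0" for i
    by (induction i) (auto intro: w)
  then show ?thesis
    unfolding zeta_def by (intro mult_le_mono2 power_mono) auto
qed

lemma Omega_mono:
  assumes \<eta>: "monotone_functional \<eta>" and fg: "mono f" "mono g" "\<And>n. f n \<le> g n"
  shows "Omega N \<eta> k f \<le> Omega N \<eta> k g"
proof -
  have "mono (\<lambda>m. g (\<eta> m g))"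
    using monotone_functionalD[OF \<eta> _ fg(2)] fg(2) by (simp add: mono_def)
  moreover have "f (\<eta> m f) \<le> g (\<eta> m g)" for m
    using fg(3) monoD[OF fg(2) monotone_functionalD[OF \<eta> order_refl fg(2,3)]]
    by (rule order_trans)
  ultimately show ?thesis
    unfolding Omega_def by (intro monotone_functionalD[OF \<eta>] zeta_mono fg)
qed

text \<open>\<open>Phi\<close> evaluates its rates at modified counterfunctions, whose values must
  then be compared. In the proof, \<open>h f\<close> is the counterfunction that
  \<open>mu_tilde\<close> passes to \<open>Omega\<close>, and it grows with
  \<open>f\<close>.\<close>

lemma mu_tilde_mono:
  assumes \<Delta>: "mono \<Delta>" and t: "mono t" and \<eta>: "monotone_functional \<eta>"
    and fg: "mono f" "mono g" "\<And>n. f n \<le> g n"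
  shows "mu_tilde N R \<Delta> t \<eta> k f \<le> mu_tilde N R \<Delta> t \<eta> k g"
proof -
  define \<sigma> where "\<sigma> = sigma1 N \<Delta> ((k + 1)\<^sup>2 - 1)"
  define h where "h f n = 2 * (64 * N * R * (k + 1)\<^sup>2 * (f (\<sigma> n) + 1) * t (f (\<sigma> n)) - 1) + 2"
    for f and n :: nat
  have \<sigma>: "mono \<sigma>"
    using \<Delta> by (auto simp: \<sigma>_def sigma1_def mono_def)
  have h: "h f m \<le> h g n" if "f (\<sigma> m) \<le> g (\<sigma> n)" for f g m n
    unfolding h_def using that monoD[OF t that]
    by (intro add_le_mono1 mult_le_mono diff_le_mono) auto
  have "mono (h f)" if "mono f" for f
    using monoD[OF that monoD[OF \<sigma>]] h by (simp add: mono_def)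
  moreover have "h f n \<le> h g n" for n
    by (intro h fg)
  ultimately have "Omega N \<eta> k' (h f) \<le> Omega N \<eta> k' (h g)" for k'
    using fg by (intro Omega_mono \<eta>) auto
  then show ?thesis
    unfolding mu_tilde_def Let_def h_def \<sigma>_def[symmetric] by (rule monoD[OF \<sigma>])
qed

lemma mono_tilde: "mono f \<Longrightarrow> mono (tilde f M)"
  by (auto simp: tilde_def mono_def)

lemma tilde_le: "mono f \<Longrightarrow> M \<le> M' \<Longrightarrow> tilde f M n \<le> tilde f M' n"
  by (simp add: tilde_def monoD max.mono)

section \<open>Combining two metastable properties\<close>

text \<open>\<open>n\<^sub>1\<close> is chosen for \<open>fbar\<close>, which anticipates every
  \<open>n\<^sub>2\<close> that \<open>\<phi>\<^sub>2\<close> can then yield for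
  \<open>tilde f n\<^sub>1\<close>; the interval at their maximum lies in both given ones.
  Monotonicity of \<open>\<phi>\<^sub>2\<close> makes \<open>fbar\<close> monotone and allows
  \<open>n\<^sub>1\<close> to be replaced by its bound.\<close>

lemma Phi_bar_metastable:
  fixes P\<^sub>1 P\<^sub>2 :: "nat set \<Rightarrow> bool"
  assumes anti: "\<And>X Y. X \<subseteq> Y \<Longrightarrow> P\<^sub>1 Y \<Longrightarrow> P\<^sub>1 X" "\<And>X Y. X \<subseteq> Y \<Longrightarrow> P\<^sub>2 Y \<Longrightarrow> P\<^sub>2 X"
    and rate\<^sub>1: "\<And>f. mono f \<Longrightarrow> \<exists>n\<le>\<phi>\<^sub>1 k f. P\<^sub>1 {n..f n}"
    and rate\<^sub>2: "\<And>f. mono f \<Longrightarrow> \<exists>n\<le>\<phi>\<^sub>2 k f. P\<^sub>2 {n..f n}"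
    and mono\<^sub>2: "\<And>f g. mono f \<Longrightarrow> mono g \<Longrightarrow> (\<And>n. f n \<le> g n) \<Longrightarrow> \<phi>\<^sub>2 k f \<le> \<phi>\<^sub>2 k g"
    and f: "mono f"
  shows "\<exists>n\<le>Phi_bar \<phi>\<^sub>1 \<phi>\<^sub>2 k f. P\<^sub>1 {n..f n} \<and> P\<^sub>2 {n..f n}"
proof -
  define fbar where "fbar m = tilde f (\<phi>\<^sub>2 k (tilde f m)) m" for m
  have \<phi>\<^sub>2_le: "\<phi>\<^sub>2 k (tilde f m) \<le> \<phi>\<^sub>2 k (tilde f n)" if "m \<le> n" for m n
    using that f by (intro mono\<^sub>2 mono_tilde tilde_le)
  have fbar: "fbar m = f (max m (\<phi>\<^sub>2 k (tilde f m)))" for m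
    by (simp add: fbar_def tilde_def)
  have "mono fbar"
    unfolding mono_def fbar using \<phi>\<^sub>2_le by (intro allI impI monoD[OF f] max.mono) auto
  then obtain n\<^sub>1 where n\<^sub>1: "n\<^sub>1 \<le> \<phi>\<^sub>1 k fbar" "P\<^sub>1 {n\<^sub>1..fbar n\<^sub>1}"
    using rate\<^sub>1 by blast
  obtain n\<^sub>2 where n\<^sub>2: "n\<^sub>2 \<le> \<phi>\<^sub>2 k (tilde f n\<^sub>1)" "P\<^sub>2 {n\<^sub>2..tilde f n\<^sub>1 n\<^sub>2}"
    using rate\<^sub>2 mono_tilde f by blast
  define n where "n = max n\<^sub>1 n\<^sub>2"
  have "f n \<le> fbar n\<^sub>1"
    unfolding fbar n_def using n\<^sub>2(1) by (intro monoD[OF f] max.mono) auto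
  then have "P\<^sub>1 {n..f n}"
    by (intro anti(1)[OF _ n\<^sub>1(2)]) (auto simp: n_def)
  moreover have "P\<^sub>2 {n..f n}"
    by (intro anti(2)[OF _ n\<^sub>2(2)]) (auto simp: n_def tilde_def max.commute)
  moreover have "n \<le> Phi_bar \<phi>\<^sub>1 \<phi>\<^sub>2 k f"
    unfolding n_def Phi_bar_def Let_def fbar_def[symmetric]
    using n\<^sub>1(1) order_trans[OF n\<^sub>2(1) \<phi>\<^sub>2_le[OF n\<^sub>1(1)]] by (rule max.mono)
  ultimately show ?thesis by blast
qed

text \<open>Either property may be treated first; both orders give a bound, hence so does the
  minimum.\<close>

lemma Phi_metastable:
  fixes P\<^sub>1 P\<^sub>2 :: "nat set \<Rightarrow> bool"
  assumes "\<And>X Y. X \<subseteq> Y \<Longrightarrow> P\<^sub>1 Y \<Longrightarrow> P\<^sub>1 X" "\<And>X Y. X \<subseteq> Y \<Longrightarrow> P\<^sub>2 Y \<Longrightarrow> P\<^sub>2 X"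
    and "\<And>f. mono f \<Longrightarrow> \<exists>n\<le>\<phi>\<^sub>1 k f. P\<^sub>1 {n..f n}"
    and "\<And>f. mono f \<Longrightarrow> \<exists>n\<le>\<phi>\<^sub>2 k f. P\<^sub>2 {n..f n}"
    and "\<And>f g. mono f \<Longrightarrow> mono g \<Longrightarrow> (\<And>n. f n \<le> g n) \<Longrightarrow> \<phi>\<^sub>1 k f \<le> \<phi>\<^sub>1 k g"
    and "\<And>f g. mono f \<Longrightarrow> mono g \<Longrightarrow> (\<And>n. f n \<le> g n) \<Longrightarrow> \<phi>\<^sub>2 k f \<le> \<phi>\<^sub>2 k g"
    and "mono f"
  shows "\<exists>n\<le>Phi \<phi>\<^sub>1 \<phi>\<^sub>2 k f. P\<^sub>1 {n..f n} \<and> P\<^sub>2 {n..f n}"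
proof -
  have "\<exists>n\<le>Phi_bar \<phi>\<^sub>1 \<phi>\<^sub>2 k f. P\<^sub>1 {n..f n} \<and> P\<^sub>2 {n..f n}"
    by (rule Phi_bar_metastable[of P\<^sub>1 P\<^sub>2 \<phi>\<^sub>1 k \<phi>\<^sub>2 f]) (fact assms)+
  moreover have "\<exists>n\<le>Phi_bar \<phi>\<^sub>2 \<phi>\<^sub>1 k f. P\<^sub>2 {n..f n} \<and> P\<^sub>1 {n..f n}"
    by (rule Phi_bar_metastable[of P\<^sub>2 P\<^sub>1 \<phi>\<^sub>2 k \<phi>\<^sub>1 f]) (fact assms)+
  ultimately show ?thesis
    unfolding Phi_def min_def by (simp split: if_split) blast
qed

text \<open>Balls around the fixed point \<open>q\<close> are convex and invariant under the
  nonexpansive resolvent.\<close>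

lemma resolvent_combination_bound:
  fixes A :: "'a::{real_inner, complete_space} \<Rightarrow> 'a set"
  assumes A: "maximal_monotone_operator A" and c: "0 < c" and q: "q \<in> operator_zeros A"
    and a: "0 \<le> a" "a \<le> 1" and "norm (u - q) \<le> r" "norm (y - q) \<le> r"
  shows "norm (resolvent c A (a *\<^sub>R u + (1 - a) *\<^sub>R y) - q) \<le> r"
proof -
  have "a *\<^sub>R u + (1 - a) *\<^sub>R y \<in> cball q r"
    using assms by (intro convexD[OF convex_cball]) (auto simp: dist_norm norm_minus_commute)
  then show ?thesis
    using resolvent_nonexpansive[OF A c, of "a *\<^sub>R u + (1 - a) *\<^sub>R y" q]
    by (simp add: resolvent_zero[OF A c q] dist_norm norm_minus_commute)
qed

section \<open>Analysis of the iteration\<close>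

locale alternating_resolvents =
  fixes A B :: "'a::{real_inner, complete_space} \<Rightarrow> 'a set"
    and u q :: 'a and y :: "nat \<Rightarrow> 'a"
    and \<alpha> lam \<beta> \<mu> :: "nat \<Rightarrow> real"
    and N R :: nat and \<Delta> t :: "nat \<Rightarrow> nat"
    and \<eta> :: "nat \<Rightarrow> (nat \<Rightarrow> nat) \<Rightarrow> nat"
  assumes A: "maximal_monotone_operator A" and B: "maximal_monotone_operator B"
    and q: "q \<in> operator_zeros A" "q \<in> operator_zeros B"
    and weights: "\<And>n. 0 < \<alpha> n \<and> \<alpha> n < 1" "\<And>n. 0 < lam n \<and> lam n < 1"
    and y_odd: "\<And>n. y (2 * n + 1) = resolvent (\<beta> n) A (\<alpha> n *\<^sub>R u + (1 - \<alpha> n) *\<^sub>R y (2 * n))"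
    and y_even: "\<And>n. y (2 * n + 2) = resolvent (\<mu> n) B (lam n *\<^sub>R u + (1 - lam n) *\<^sub>R y (2 * n + 1))"
    and N: "N \<noteq> 0" "2 * norm (u - q) \<le> real N" "norm (y 0 - q) \<le> real N"
    and R: "R \<noteq> 0"
    and mono_\<Delta>: "mono \<Delta>" and mono_t: "mono t"
    and diverge: "rate_of_divergence \<Delta> \<alpha> \<or> rate_of_divergence \<Delta> lam"
    and ge_R: "\<And>n. 1 / real R \<le> \<beta> n" "\<And>n. 1 / real R \<le> \<mu> n"
    and le_t: "\<And>n. \<beta> n \<le> real (t n)" "\<And>n. \<mu> n \<le> real (t n)"
    and mono_\<eta>: "monotone_functional \<eta>"
    and regular: "quasi_rate_of_asymptotic_regularity \<eta> y
      (resolvent (1 / real R) A) (resolvent (1 / real R) B)"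
begin

lemma R_pos: "0 < 1 / real R"
  using R by simp

lemma steps_pos: "0 < \<beta> n" "0 < \<mu> n"
  using less_le_trans[OF R_pos] ge_R by blast+

lemma u_bound: "norm (u - q) \<le> real N"
  using N(2) norm_ge_zero[of "u - q"] by linarith

lemma y_bound: "norm (y n - q) \<le> real N"
proof -
  have odd: "norm (y (2 * n + 1) - q) \<le> real N" if "norm (y (2 * n) - q) \<le> real N" for n
    unfolding y_odd using weights(1)[of n] that
    by (intro resolvent_combination_bound[OF A] steps_pos q u_bound) auto
  have even: "norm (y (2 * n + 2) - q) \<le> real N" if "norm (y (2 * n + 1) - q) \<le> real N" for n
    unfolding y_even using weights(2)[of n] that
    by (intro resolvent_combination_bound[OF B] steps_pos q u_bound) auto
  have *: "norm (y (2 * n) - q) \<le> real N" for n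
    by (induction n) (use N(3) odd even in auto)
  show ?thesis
    using *[of "n div 2"] odd[OF *, of "n div 2"]
    by (cases "even n") (auto elim!: evenE oddE)
qed

text \<open>Weights are below 1, so the first \<open>n\<close> of them sum to at most
  \<open>n\<close>; divergence at \<open>n\<close> plus the rounded logarithm leaves at least the
  logarithm for the block from \<open>n\<close> on.\<close>

lemma weight_sum_ge:
  obtains c where "\<And>n. c n \<in> {\<alpha> n, lam n}"
    "\<And>n i. sigma1 N \<Delta> k n \<le> i \<Longrightarrow> n \<le> i \<and> ln (16 * (real N)\<^sup>2 * (real k + 1)) \<le> (\<Sum>j = n..<i. c j)"
proof -
  obtain c where c: "rate_of_divergence \<Delta> c" "c = \<alpha> \<or> c = lam"
    using diverge by blast
  have c1: "0 < c n \<and> c n < 1" for n using c(2) weights by auto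
  have sum_le: "(\<Sum>j = 0..<n. c j) \<le> real n" for n
    using sum_bounded_above[of "{0..<n}" c 1] c1 by (simp add: less_imp_le)
  have "n \<le> i \<and> ln (16 * (real N)\<^sup>2 * (real k + 1)) \<le> (\<Sum>j = n..<i. c j)"
    if i: "sigma1 N \<Delta> k n \<le> i" for n i
  proof -
    define L where "L = nat \<lceil>ln (16 * (real N)\<^sup>2 * (real k + 1))\<rceil>"
    have L: "ln (16 * (real N)\<^sup>2 * (real k + 1)) \<le> real L"
      unfolding L_def by linarith
    \<comment> \<open>The \<open>+ 1\<close> in \<open>sigma1\<close> fits the closed range of
      \<open>rate_of_divergence\<close> into the half-open range below \<open>i\<close>.\<close>
    have "\<Delta> (n + L) + 1 \<le> i" using i by (simp add: sigma1_def L_def)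
    then obtain m where m: "i = Suc (\<Delta> (n + L) + m)"
      by (metis add.commute add_Suc le_iff_add plus_1_eq_Suc)
    have "real (n + L) \<le> (\<Sum>j = 0..\<Delta> (n + L) + m. c j)"
      using c(1) unfolding rate_of_divergence_def by blast
    then have *: "real (n + L) \<le> (\<Sum>j = 0..<i. c j)"
      unfolding m atLeastLessThanSuc_atLeastAtMost .
    then have "n \<le> i" using sum_le[of i] by linarith
    moreover have "(\<Sum>j = 0..<n. c j) + (\<Sum>j = n..<i. c j) = (\<Sum>j = 0..<i. c j)"
      using \<open>n \<le> i\<close> by (simp add: sum.atLeastLessThan_concat)
    ultimately show ?thesis using * L sum_le[of n] by simp
  qed
  then show ?thesis using that[of c] c(2) by auto
qed

text \<open>A round applies \<open>resolvent_step\<close> twice, each time adding at most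
  \<open>12 * N * \<delta>\<close>. The product of the two contraction factors is at most
  \<open>1 - c i\<close>, hence at most \<open>exp (- c i)\<close>, whichever of the two weights
  \<open>c i\<close> is.\<close>

lemma recursion:
  assumes c: "\<And>j. c j \<in> {\<alpha> j, lam j}"
    and xq: "norm (x - q) \<le> real N"
    and \<delta>: "0 \<le> \<delta>"
      "\<And>j. j < p \<Longrightarrow> norm (resolvent (\<beta> j) A x - x) \<le> \<delta>"
      "\<And>j. j < p \<Longrightarrow> norm (resolvent (\<mu> j) B x - x) \<le> \<delta>"
    and \<rho>: "0 \<le> \<rho>" "\<And>m. n \<le> m \<Longrightarrow> m \<le> 2 * p \<Longrightarrow> (u - x) \<bullet> (y m - x) \<le> \<rho>"
    and i: "n \<le> i" "i \<le> p"
  shows "(norm (y (2 * i) - x))\<^sup>2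
    \<le> \<rho> + (4 * (real N)\<^sup>2 * exp (- (\<Sum>j = n..<i. c j)) + 24 * real N * \<delta> * real (i - n))"
  using i
proof (induction i rule: dec_induct)
  case base
  have "(norm (y (2 * n) - x))\<^sup>2 \<le> (2 * real N)\<^sup>2"
    using norm_triangle_ineq4[of "y (2 * n) - q" "x - q"] y_bound[of "2 * n"] xq
    by (intro power_mono) auto
  then show ?case using \<rho>(1) by simp
next
  case (step i)
  define e where "e = 12 * real N * \<delta>"
  define M where "M = 4 * (real N)\<^sup>2 * exp (- (\<Sum>j = n..<i. c j))"
  define X where "X = M + 2 * e * real (i - n)"
  have e: "0 \<le> e" using \<delta>(1) by (simp add: e_def)
  have M: "0 \<le> M" by (simp add: M_def)
  have X: "0 \<le> X" using e M by (simp add: X_def)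
  have "(norm (y (2 * i) - x))\<^sup>2 \<le> \<rho> + X"
    using step by (simp add: X_def M_def e_def)
  then have odd: "(norm (y (2 * i + 1) - x))\<^sup>2 \<le> \<rho> + (1 - \<alpha> i) * X + e"
    unfolding e_def using weights(1)[of i] step X
    by (intro resolvent_step[OF A steps_pos(1) _ _ y_odd u_bound y_bound y_bound xq \<delta>(2) \<rho>(2)]) auto
  have X': "0 \<le> (1 - \<alpha> i) * X + e"
    using weights(1)[of i] e X by (simp add: mult_nonneg_nonneg)
  have "(norm (y (2 * i + 2) - x))\<^sup>2 \<le> \<rho> + (1 - lam i) * ((1 - \<alpha> i) * X + e) + e"
    unfolding e_def using weights(2)[of i] step X' odd
    by (intro resolvent_step[OF B steps_pos(2) _ _ y_even u_bound y_bound y_bound xq \<delta>(3) \<rho>(2)])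
      (auto simp: e_def)
  also have "(1 - lam i) * ((1 - \<alpha> i) * X + e) = (1 - lam i) * (1 - \<alpha> i) * X + (1 - lam i) * e"
    by (simp add: algebra_simps)
  also have "(1 - lam i) * e \<le> e"
    using weights(2)[of i] e by (simp add: mult_left_le_one_le)
  also have "(1 - lam i) * (1 - \<alpha> i) * X = (1 - lam i) * (1 - \<alpha> i) * M
      + (1 - lam i) * (1 - \<alpha> i) * (2 * e * real (i - n))"
    by (simp add: X_def algebra_simps)
  also have "(1 - lam i) * (1 - \<alpha> i) * (2 * e * real (i - n)) \<le> 2 * e * real (i - n)"
    using weights[of i] e by (intro mult_left_le_one_le mult_nonneg_nonneg mult_le_one) auto
  also have "(1 - lam i) * (1 - \<alpha> i) * M \<le> exp (- c i) * M"
  proof (rule mult_right_mono[OF _ M])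
    have "(1 - lam i) * (1 - \<alpha> i) \<le> 1 - lam i" "(1 - lam i) * (1 - \<alpha> i) \<le> 1 - \<alpha> i"
      using weights[of i] by (auto intro: mult_right_le_one_le mult_left_le_one_le)
    then have "(1 - lam i) * (1 - \<alpha> i) \<le> 1 + (- c i)"
      using c[of i] by auto
    also have "\<dots> \<le> exp (- c i)" by (rule exp_ge_add_one_self)
    finally show "(1 - lam i) * (1 - \<alpha> i) \<le> exp (- c i)" .
  qed
  also have "exp (- c i) * M = 4 * (real N)\<^sup>2 * exp (- (\<Sum>j = n..<Suc i. c j))"
    using step.hyps by (simp add: M_def exp_add[symmetric] mult_ac)
  finally show ?case
    using step.hyps by (simp add: e_def Suc_diff_le algebra_simps)
qed

text \<open>\<open>recursion\<close> bounds a squared distance, so accuracies are set through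
  \<open>(k + 1)\<^sup>2\<close>: \<open>k2\<close> for the inner products, \<open>k1\<close> for
  the weight sum. The number of rounds depends on \<open>n\<close>, so the accuracy of
  \<open>x\<close> must too, whence the counterfunction \<open>2 * g n + 2\<close>.\<close>

lemma mu_tilde_metastable:
  assumes f: "mono f"
  shows "\<exists>n\<le>mu_tilde N R \<Delta> t \<eta> k f. \<exists>x. \<forall>i\<in>{n..f n}. norm (y (2 * i) - x) \<le> 1 / (real k + 1)"
proof -
  define k1 where "k1 = (k + 1)\<^sup>2 - 1"
  define k2 where "k2 = 16 * (k + 1)\<^sup>2 - 1"
  define p where "p n = f (sigma1 N \<Delta> k1 n)" for n
  define g where "g n = 64 * N * R * (k + 1)\<^sup>2 * (p n + 1) * t (p n) - 1" for n
  have mono_\<sigma>: "mono (sigma1 N \<Delta> k1)"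
    using mono_\<Delta> by (auto simp: sigma1_def mono_def)
  then have mono_p: "mono p"
    using f by (auto simp: p_def mono_def)
  have mono_g: "mono g"
    using mono_p mono_t unfolding g_def mono_def
    by (intro allI impI diff_le_mono mult_le_mono) auto
  then have mono_h: "mono (\<lambda>n. 2 * g n + 2)"
    by (auto simp: mono_def)
  have k1: "real k1 + 1 = (real k + 1)\<^sup>2" and k2: "real k2 + 1 = 16 * (real k + 1)\<^sup>2"
    by (simp_all add: k1_def k2_def of_nat_diff Suc_le_eq add.commute)
  note T = resolvent_nonexpansive[OF A R_pos] resolvent_zero[OF A R_pos q(1)]
    and T' = resolvent_nonexpansive[OF B R_pos] resolvent_zero[OF B R_pos q(2)]
  obtain n x where n: "n \<le> Omega N \<eta> k2 (\<lambda>n. 2 * g n + 2)"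
    and x: "x \<in> approx_common_fixed (resolvent (1 / real R) A) (resolvent (1 / real R) B) q N (2 * g n + 2)"
    and \<rho>: "\<And>m. n \<le> m \<Longrightarrow> m \<le> 2 * g n + 2 \<Longrightarrow> (u - x) \<bullet> (y m - x) \<le> 1 / (16 * (real k + 1)\<^sup>2)"
    using Omega_projection[OF T T' N(1,2) y_bound mono_\<eta> regular mono_h, of k2]
    unfolding k2 by fastforce
  have xq: "norm (x - q) \<le> real N" using x by (simp add: approx_common_fixed_def)
  \<comment> \<open>Positivity of the step sizes bounded by \<open>t\<close> keeps the subtraction
    in \<open>g\<close> from truncating.\<close>
  have t1: "1 \<le> t (p n)"
    using less_le_trans[OF steps_pos(1) le_t(1)[of "p n"]] by simp
  have gn: "g n + 1 = 64 * N * R * (k + 1)\<^sup>2 * (p n + 1) * t (p n)"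
    using N(1) R t1 by (simp add: g_def)
  have "1 * (p n + 1) * 1 \<le> 64 * N * R * (k + 1)\<^sup>2 * (p n + 1) * t (p n)"
    using N(1) R t1 by (intro mult_le_mono order_refl) (auto simp: Suc_le_eq)
  then have "p n + 1 \<le> g n + 1"
    unfolding gn by simp
  \<comment> \<open>This keeps all iterates up to index \<open>2 * p n\<close> in the range where
    the inner products are controlled.\<close>
  then have pg: "p n \<le> g n" by simp
  \<comment> \<open>The displacement tolerated for every step size in use. Passing from
    \<open>1 / R\<close> to \<open>d \<le> t (p n)\<close> costs a factor of at most
    \<open>R * t (p n)\<close>, which is why both enter \<open>g\<close>.\<close>
  define \<delta> where "\<delta> = 1 / (128 * real N * (real k + 1)\<^sup>2 * (real (p n) + 1))"
  have "1 / (real (2 * g n + 2) + 1) \<le> 1 / (2 * real (g n + 1))"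
    by (simp add: frac_le)
  also have "\<dots> = 1 / (128 * real N * real R * (real k + 1)\<^sup>2 * (real (p n) + 1) * real (t (p n)))"
    unfolding gn by (simp add: algebra_simps)
  also have "\<dots> = \<delta> / (real R * real (t (p n)))"
    by (simp add: \<delta>_def)
  finally have small: "1 / (real (2 * g n + 2) + 1) \<le> \<delta> / (real R * real (t (p n)))" .
  have disp: "norm (resolvent d S x - x) \<le> \<delta>"
    if S: "maximal_monotone_operator S" and d: "1 / real R \<le> d" "d \<le> real (t j)" "j < p n"
      and le: "norm (resolvent (1 / real R) S x - x) \<le> 1 / (real (2 * g n + 2) + 1)" for S d j
  proof -
    have "t j \<le> t (p n)" using mono_t d(3) by (simp add: monoD)
    then have dt: "d \<le> real (t (p n))" using d(2) by linarith
    have "norm (resolvent d S x - x) \<le> d / (1 / real R) * norm (resolvent (1 / real R) S x - x)"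
      by (rule resolvent_displacement_le[OF S R_pos d(1)])
    also have "\<dots> = (d * real R) * norm (resolvent (1 / real R) S x - x)"
      by simp
    also have "\<dots> \<le> (real (t (p n)) * real R) * (\<delta> / (real R * real (t (p n))))"
      using dt order_trans[OF le small] by (intro mult_mono) auto
    also have "\<dots> = \<delta>" using R t1 by simp
    finally show ?thesis .
  qed
  define m where "m = sigma1 N \<Delta> k1 n"
  obtain c where c: "\<And>n. c n \<in> {\<alpha> n, lam n}"
    and c_sum: "\<And>n i. sigma1 N \<Delta> k1 n \<le> i \<Longrightarrow>
      n \<le> i \<and> ln (16 * (real N)\<^sup>2 * (real k1 + 1)) \<le> (\<Sum>j = n..<i. c j)"
    using weight_sum_ge[where k = k1] by blast
  have "norm (y (2 * i) - x) \<le> 1 / (real k + 1)" if i: "i \<in> {m..f m}" for i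
  proof -
    have ip: "i \<le> p n" using i by (simp add: m_def p_def)
    have ni: "n \<le> i" and ln: "ln (16 * (real N)\<^sup>2 * (real k + 1)\<^sup>2) \<le> (\<Sum>j = n..<i. c j)"
      using c_sum[of n i] i by (auto simp: m_def k1)
    have "(norm (y (2 * i) - x))\<^sup>2 \<le> 1 / (16 * (real k + 1)\<^sup>2) +
        (4 * (real N)\<^sup>2 * exp (- (\<Sum>j = n..<i. c j)) + 24 * real N * \<delta> * real (i - n))"
    proof (rule recursion[OF c xq])
      show "norm (resolvent (\<beta> j) A x - x) \<le> \<delta>" if "j < p n" for j
        using x by (intro disp[OF A ge_R(1) le_t(1) that]) (simp add: approx_common_fixed_def)
      show "norm (resolvent (\<mu> j) B x - x) \<le> \<delta>" if "j < p n" for j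
        using x by (intro disp[OF B ge_R(2) le_t(2) that]) (simp add: approx_common_fixed_def)
      show "(u - x) \<bullet> (y m - x) \<le> 1 / (16 * (real k + 1)\<^sup>2)" if "n \<le> m" "m \<le> 2 * p n" for m
        using that pg by (intro \<rho>) auto
    qed (use ni ip in \<open>auto simp: \<delta>_def\<close>)
    \<comment> \<open>The logarithm in \<open>sigma1\<close> is designed to bring the initial bound
      \<open>4 * N\<^sup>2\<close> down to a quarter of the squared target.\<close>
    moreover have "4 * (real N)\<^sup>2 * exp (- (\<Sum>j = n..<i. c j)) \<le> 1 / (4 * (real k + 1)\<^sup>2)"
    proof -
      have pos: "0 < 16 * (real N)\<^sup>2 * (real k + 1)\<^sup>2" using N(1) by simp
      have "exp (- (\<Sum>j = n..<i. c j)) \<le> exp (- ln (16 * (real N)\<^sup>2 * (real k + 1)\<^sup>2))"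
        using ln by simp
      also have "\<dots> = 1 / (16 * (real N)\<^sup>2 * (real k + 1)\<^sup>2)"
        using pos by (simp add: exp_minus inverse_eq_divide)
      finally have "4 * (real N)\<^sup>2 * exp (- (\<Sum>j = n..<i. c j))
          \<le> 4 * (real N)\<^sup>2 * (1 / (16 * (real N)\<^sup>2 * (real k + 1)\<^sup>2))"
        by (intro mult_left_mono) auto
      then show ?thesis using N(1) by simp
    qed
    moreover have "24 * real N * \<delta> * real (i - n) \<le> 1 / (4 * (real k + 1)\<^sup>2)"
    proof -
      have "24 * real N * \<delta> * real (i - n) \<le> 24 * real N * \<delta> * (real (p n) + 1)"
        using ip by (intro mult_left_mono) (auto simp: \<delta>_def)
      also have "\<dots> = 3 / (16 * (real k + 1)\<^sup>2)"
      proof -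
        have cancel: "24 * a * (1 / (128 * a * b * c)) * c = 3 / (16 * b)"
          if "a \<noteq> 0" "c \<noteq> 0" for a b c :: real
          using that by simp
        show ?thesis unfolding \<delta>_def by (rule cancel) (use N(1) in auto)
      qed
      also have "\<dots> \<le> 1 / (4 * (real k + 1)\<^sup>2)"
        by (simp add: divide_simps)
      finally show ?thesis .
    qed
    \<comment> \<open>The three shares add up to 9/16 of the squared target.\<close>
    moreover have "1 / (16 * (real k + 1)\<^sup>2) + (1 / (4 * (real k + 1)\<^sup>2) + 1 / (4 * (real k + 1)\<^sup>2))
        \<le> (1 / (real k + 1))\<^sup>2"
      by (simp add: power_divide divide_simps)
    ultimately have "(norm (y (2 * i) - x))\<^sup>2 \<le> (1 / (real k + 1))\<^sup>2"
      by linarith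
    then show ?thesis by (rule power2_le_imp_le) simp
  qed
  moreover have "m \<le> mu_tilde N R \<Delta> t \<eta> k f"
    unfolding m_def mu_tilde_def Let_def
      k1_def[symmetric] k2_def[symmetric] p_def[symmetric] g_def[symmetric]
    using monoD[OF mono_\<sigma> n] .
  ultimately show ?thesis by blast
qed

text \<open>On a common interval the even iterates are \<open>\<epsilon>\<close>-close to some
  \<open>x\<close> and each odd one is \<open>\<epsilon>\<close>-close to its predecessor. All are
  then within \<open>4 * \<epsilon>\<close> of each other, and \<open>4 * k + 3\<close> makes this
  \<open>1 / (k + 1)\<close>.\<close>

lemma mu_metastable:
  assumes mono_\<eta>': "monotone_functional \<eta>'"
    and \<eta>': "quasi_rate_of_convergence \<eta>' (\<lambda>n. norm (y (n + 1) - y n))"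
    and f: "mono f"
  shows "\<exists>n\<le>mu N R \<Delta> t \<eta> \<eta>' k f. \<forall>i\<in>{n..f n}. \<forall>j\<in>{n..f n}. norm (y i - y j) \<le> 1 / (real k + 1)"
proof -
  define \<psi>\<^sub>1 where "\<psi>\<^sub>1 = (\<lambda>k f. \<eta>' (4 * k + 3) (\<lambda>n. 2 * f n))"
  define \<psi>\<^sub>2 where "\<psi>\<^sub>2 = (\<lambda>k f. mu_tilde N R \<Delta> t \<eta> (4 * k + 3) f)"
  define \<epsilon> where "\<epsilon> = 1 / (real (4 * k + 3) + 1)"
  define P\<^sub>1 where "P\<^sub>1 X \<longleftrightarrow> (\<forall>l\<in>X. norm (y (2 * l + 1) - y (2 * l)) \<le> \<epsilon>)" for X
  define P\<^sub>2 where "P\<^sub>2 X \<longleftrightarrow> (\<exists>x. \<forall>l\<in>X. norm (y (2 * l) - x) \<le> \<epsilon>)" for X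
  have double: "mono (\<lambda>n. 2 * g n)" if "mono g" for g :: "nat \<Rightarrow> nat"
    using that by (simp add: mono_def)
  \<comment> \<open>Doubling the counterfunction covers the indices \<open>2 * l\<close> for all
    \<open>l\<close> up to \<open>g n\<close>.\<close>
  have rate\<^sub>1: "\<exists>n\<le>\<psi>\<^sub>1 k g. P\<^sub>1 {n..g n}" for g
  proof -
    obtain n where n: "n \<le> \<psi>\<^sub>1 k g" "\<And>m. m \<in> {n..2 * g n} \<Longrightarrow> \<bar>norm (y (m + 1) - y m)\<bar> \<le> \<epsilon>"
      using \<eta>' unfolding quasi_rate_of_convergence_def \<psi>\<^sub>1_def \<epsilon>_def by meson
    have "norm (y (2 * l + 1) - y (2 * l)) \<le> \<epsilon>" if "l \<in> {n..g n}" for l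
      using n(2)[of "2 * l"] that by simp
    then show ?thesis using n(1) by (auto simp: P\<^sub>1_def)
  qed
  have rate\<^sub>2: "\<exists>n\<le>\<psi>\<^sub>2 k g. P\<^sub>2 {n..g n}" if "mono g" for g
    using mu_tilde_metastable[OF that] unfolding P\<^sub>2_def \<psi>\<^sub>2_def \<epsilon>_def .
  have g: "mono (\<lambda>m. f (2 * m + 1))"
    using f by (simp add: mono_def)
  have "\<exists>n\<le>Phi \<psi>\<^sub>1 \<psi>\<^sub>2 k (\<lambda>m. f (2 * m + 1)). P\<^sub>1 {n..f (2 * n + 1)} \<and> P\<^sub>2 {n..f (2 * n + 1)}"
  proof (rule Phi_metastable[of P\<^sub>1 P\<^sub>2 \<psi>\<^sub>1 k \<psi>\<^sub>2, OF _ _ rate\<^sub>1 rate\<^sub>2 _ _ g])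
    show "P\<^sub>1 X" if "X \<subseteq> Y" "P\<^sub>1 Y" for X Y using that by (auto simp: P\<^sub>1_def)
    show "P\<^sub>2 X" if "X \<subseteq> Y" "P\<^sub>2 Y" for X Y using that by (auto simp: P\<^sub>2_def)
    show "\<psi>\<^sub>1 k g \<le> \<psi>\<^sub>1 k h" if "mono g" "mono h" "\<And>n. g n \<le> h n" for g h
      unfolding \<psi>\<^sub>1_def using that by (intro monotone_functionalD[OF mono_\<eta>'] double) auto
    show "\<psi>\<^sub>2 k g \<le> \<psi>\<^sub>2 k h" if "mono g" "mono h" "\<And>n. g n \<le> h n" for g h
      unfolding \<psi>\<^sub>2_def using that by (intro mu_tilde_mono mono_\<Delta> mono_t mono_\<eta>)
  qed
  then obtain n x where n: "n \<le> Phi \<psi>\<^sub>1 \<psi>\<^sub>2 k (\<lambda>m. f (2 * m + 1))"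
    and odd: "\<And>l. l \<in> {n..f (2 * n + 1)} \<Longrightarrow> norm (y (2 * l + 1) - y (2 * l)) \<le> \<epsilon>"
    and even: "\<And>l. l \<in> {n..f (2 * n + 1)} \<Longrightarrow> norm (y (2 * l) - x) \<le> \<epsilon>"
    unfolding P\<^sub>1_def P\<^sub>2_def by blast
  \<comment> \<open>Starting at \<open>2 * n + 1\<close> ensures that \<open>i div 2\<close> is at
    least \<open>n\<close>; being at most \<open>i\<close>, it also stays below
    \<open>f (2 * n + 1)\<close>. This is the index shift in \<open>Psi\<close>.\<close>
  have near: "norm (y i - x) \<le> 2 * \<epsilon>" if i: "i \<in> {2 * n + 1..f (2 * n + 1)}" for i
  proof -
    define l where "l = i div 2"
    have l: "l \<in> {n..f (2 * n + 1)}" using i by (auto simp: l_def)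
    have "0 \<le> \<epsilon>" by (simp add: \<epsilon>_def)
    have "i = 2 * l \<or> i = 2 * l + 1" unfolding l_def by presburger
    then show ?thesis
      using odd[OF l] even[OF l] \<open>0 \<le> \<epsilon>\<close>
        norm_triangle_ineq[of "y (2 * l + 1) - y (2 * l)" "y (2 * l) - x"] by auto
  qed
  have "norm (y i - y j) \<le> 1 / (real k + 1)"
    if "i \<in> {2 * n + 1..f (2 * n + 1)}" "j \<in> {2 * n + 1..f (2 * n + 1)}" for i j
  proof -
    have "norm (y i - y j) \<le> 4 * \<epsilon>"
      using norm_triangle_ineq4[of "y i - x" "y j - x"] near[OF that(1)] near[OF that(2)] by simp
    also have "\<dots> = 1 / (real k + 1)"
      by (simp add: \<epsilon>_def field_simps)
    finally show ?thesis .
  qed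
  moreover have "2 * n + 1 \<le> mu N R \<Delta> t \<eta> \<eta>' k f"
    using n unfolding mu_def Psi_def Let_def \<psi>\<^sub>1_def \<psi>\<^sub>2_def by simp
  ultimately show ?thesis by blast
qed

end

theorem corollary3p3:
  fixes A B :: "'a::{real_inner, complete_space} \<Rightarrow> 'a set"
    and x0 u :: 'a
    and y :: "nat \<Rightarrow> 'a"
    and \<alpha> lam \<beta> \<mu> :: "nat \<Rightarrow> real"
    and N R :: nat
    and \<Delta> t :: "nat \<Rightarrow> nat"
    and \<eta> \<eta>' :: "nat \<Rightarrow> (nat \<Rightarrow> nat) \<Rightarrow> nat"
  assumes "maximal_monotone_operator A" and "maximal_monotone_operator B"
    and "operator_zeros A \<inter> operator_zeros B \<noteq> {}"
    and "\<And>n. 0 < \<alpha> n \<and> \<alpha> n < 1" and "\<And>n. 0 < lam n \<and> lam n < 1"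
    and "\<And>n. 0 < \<beta> n" and "\<And>n. 0 < \<mu> n"
    and "y 0 = x0"
    and "\<And>n. y (2 * n + 1) = resolvent (\<beta> n) A (\<alpha> n *\<^sub>R u + (1 - \<alpha> n) *\<^sub>R y (2 * n))"
    and "\<And>n. y (2 * n + 2) = resolvent (\<mu> n) B (lam n *\<^sub>R u + (1 - lam n) *\<^sub>R y (2 * n + 1))"
    and "N \<noteq> 0"
    and "\<exists>q \<in> operator_zeros A \<inter> operator_zeros B.
           real N \<ge> Max {2 * norm (u - q), norm (x0 - q), norm q}"
    and "R \<noteq> 0" and "mono \<Delta>" and "mono t"
    and "rate_of_divergence \<Delta> \<alpha> \<or> rate_of_divergence \<Delta> lam"
    and "\<And>n. min (\<beta> n) (\<mu> n) \<ge> 1 / real R"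
    and "\<And>n. max (\<beta> n) (\<mu> n) \<le> real (t n)"
    and "monotone_functional \<eta>"
    and "quasi_rate_of_asymptotic_regularity \<eta> y (resolvent (1 / real R) A) (resolvent (1 / real R) B)"
    and "monotone_functional \<eta>'"
    and "quasi_rate_of_convergence \<eta>' (\<lambda>n. norm (y (n + 1) - y n))"
  shows "\<forall>k. \<forall>f :: nat \<Rightarrow> nat. mono f \<longrightarrow>
           (\<exists>n \<le> mu N R \<Delta> t \<eta> \<eta>' k f. \<forall>i \<in> {n..f n}. \<forall>j \<in> {n..f n}.
              norm (y i - y j) \<le> 1 / (real k + 1))"
proof -
  obtain q where q: "q \<in> operator_zeros A" "q \<in> operator_zeros B"
    and N: "2 * norm (u - q) \<le> real N" "norm (y 0 - q) \<le> real N"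
    using assms(8,12) by auto
  have steps: "1 / real R \<le> \<beta> n" "1 / real R \<le> \<mu> n" "\<beta> n \<le> real (t n)" "\<mu> n \<le> real (t n)" for n
    using assms(17,18)[of n] by simp_all
  interpret alternating_resolvents A B u q y \<alpha> lam \<beta> \<mu> N R \<Delta> t \<eta>
    by unfold_locales (fact assms q N steps)+
  show ?thesis
    using mu_metastable[OF assms(21,22)] by blast
qed

end
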